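(* Let $s\ge1$, $L\ge1$, widths $d_0=s,\dots,d_{L+1}=N_{\rm obs}$, matrices $W_\ell\in\mathbb{R}^{d_{\ell+1}\times d_\ell}$, vectors $\mathbf{v}_\ell\in\mathbb{R}^{d_{\ell+1}}$ ($\ell=0,\dots,L$), and smooth $\sigma:\mathbb{R}\to\mathbb{R}$ applied componentwise with $\sup_x|\sigma^{(n)}(x)|\le\xi\tau^n n!$ for all $n\ge1$, for some $\xi,\tau>0$. Let $\beta_j:=\max_{1\le p\le d_1}|W_{0,p,j}|$ be bounded as below, $R_\ell$ positive numbers with $\|W_\ell\|_\infty:=\max_p\sum_q|W_{\ell,p,q}|\le R_\ell$ ($\ell\ge1$), $P_0:=1$, $P_k:=\prod_{t=1}^k(\xi\tau R_t)$, $S_L:=\tau\sum_{k=0}^{L-1}P_k$ and $C_L:=\max\{\|G^{[L]}_\theta\|_\infty,P_L/S_L\}$, where $\|G^{[L]}_\theta\|_\infty=\sup_{\mathbf{y}\in[0,1]^s}\max_p|G^{[L]}_\theta(\mathbf{y})_p|$. Let a positive sequence $(b_j)_{j\ge1}$ and a constant $C>0$ be given, and suppose the network parameters are restricted so that: $R_\ell\le\rho$ for all $\ell=1,\dots,L-1$ for some $\rho>0$; $\beta_j\le b_j/S_L$ for all $j=1,\dots,s$ (i.e. $\max_p|W_{0,p,j}|\le b_j/S_L$); and $C_L\le C$. Let positive weights $\gamma_{\mathfrak u}$ ($\mathfrak u\subseteq\{1:s\}$, $\gamma_\emptyset=1$) be given. Then $S_L\le\tau L$ if $\xi\tau\rho=1$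 and $S_L\le\tau\frac{(\xi\tau\rho)^L-1}{\xi\tau\rho-1}$ otherwise, and moreover: (a) If $G:[0,1]^s\to\mathbb{R}^{N_{\rm obs}}$ satisfies $|\partial^{\boldsymbol\nu}G(\mathbf{y})_p|\le C\,|\boldsymbol\nu|!\,\mathbf{b}^{\boldsymbol\nu}$ for all $\boldsymbol\nu\in\mathbb{N}_0^s$, all $\mathbf y$ and all $1\le p\le N_{\rm obs}$, then the non-periodic network ($G^{[0]}_\theta(\mathbf{y})=W_0\mathbf{y}+\mathbf{v}_0$, $G^{[\ell]}_\theta=W_\ell\sigma(G^{[\ell-1]}_\theta)+\mathbf{v}_\ell$) satisfies the same bound, and for all $p$: $$\max\{\|G(\cdot)_p\|^2_{\mathcal{W}_{1,\boldsymbol\gamma}},\|G^{[L]}_\theta(\cdot)_p\|^2_{\mathcal{W}_{1,\boldsymbol\gamma}}\}\le C^2\sum_{\mathfrak u}\frac1{\gamma_{\mathfrak u}}\Big(|\mathfrak u|!\prod_{j\in\mathfrak u}b_j\Big)^2,$$ $$\|(G(\cdot)_p-G^{[L]}_\theta(\cdot)_p)^2\|^2_{\mathcal{W}_{1,\boldsymbol\gamma}}\le16C^4\sum_{\mathfrak u}\frac1{\gamma_{\mathfrak u}}\Big((|\mathfrak u|+1)!\prod_{j\in\mathfrak u}b_j\Big)^2.$$ (b) If $G:[0,1]^s\to\mathbb{R}^{N_{\rm obs}}$ is one-periodic in each variable and satisfies $|\partial^{\boldsymbol\nu}G(\mathbf{y})_p|\le C(2\pi)^{|\boldsymbol\nu|}\sum_{\mathbf{m}\le\boldsymbol\nu}|\mathbf{m}|!\,\mathbf{b}^{\mathbf{m}}\mathcal{S}(\boldsymbol\nu,\mathbf{m})$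 for all $\boldsymbol\nu$, $\mathbf y$, $p$, then the periodic network ($G^{[0]}_\theta(\mathbf{y})=W_0\sin(2\pi\mathbf{y})+\mathbf{v}_0$, $G^{[\ell]}_\theta=W_\ell\sigma(G^{[\ell-1]}_\theta)+\mathbf{v}_\ell$) satisfies the same bound, and for every integer $\alpha\ge1$ and all $p$: $$\max\{\|G(\cdot)_p\|^2_{\mathcal{W}_{\alpha,\boldsymbol\gamma}},\|G^{[L]}_\theta(\cdot)_p\|^2_{\mathcal{W}_{\alpha,\boldsymbol\gamma}}\}\le C^2\sum_{\mathfrak u}\frac{(2\pi)^{2\alpha|\mathfrak u|}}{\gamma_{\mathfrak u}}\Big(\sum_{\mathbf m_{\mathfrak u}\le\boldsymbol\alpha_{\mathfrak u}}|\mathbf m_{\mathfrak u}|!\,\mathcal{S}(\boldsymbol\alpha_{\mathfrak u},\mathbf m_{\mathfrak u})\prod_{j\in\mathfrak u}b_j^{m_j}\Big)^2,$$ $$\|(G(\cdot)_p-G^{[L]}_\theta(\cdot)_p)^2\|^2_{\mathcal{W}_{\alpha,\boldsymbol\gamma}}\le16C^4\sum_{\mathfrak u}\frac{(2\pi)^{2\alpha|\mathfrak u|}}{\gamma_{\mathfrak u}}\Big(\sum_{\mathbf m_{\mathfrak u}\le\boldsymbol\alpha_{\mathfrak u}}(|\mathbf m_{\mathfrak u}|+1)!\,\mathcal{S}(\boldsymbol\alpha_{\mathfrak u},\mathbf m_{\mathfrak u})\prod_{j\in\mathfrak u}b_j^{m_j}\Big)^2.$$ (c) Under the hypotheses of (b),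 for every integer $\alpha\ge2$ and all $p$: $$\max\{\|G(\cdot)_p\|_{\mathcal{K}_{\alpha,\boldsymbol\gamma}},\|G^{[L]}_\theta(\cdot)_p\|_{\mathcal{K}_{\alpha,\boldsymbol\gamma}}\}\le C\max_{\mathfrak u}\frac{(2\pi)^{\alpha|\mathfrak u|}}{\gamma_{\mathfrak u}}\sum_{\mathbf m_{\mathfrak u}\le\boldsymbol\alpha_{\mathfrak u}}|\mathbf m_{\mathfrak u}|!\,\mathcal{S}(\boldsymbol\alpha_{\mathfrak u},\mathbf m_{\mathfrak u})\prod_{j\in\mathfrak u}b_j^{m_j},$$ $$\|(G(\cdot)_p-G^{[L]}_\theta(\cdot)_p)^2\|_{\mathcal{K}_{\alpha,\boldsymbol\gamma}}\le4C^2\max_{\mathfrak u}\frac{(2\pi)^{\alpha|\mathfrak u|}}{\gamma_{\mathfrak u}}\sum_{\mathbf m_{\mathfrak u}\le\boldsymbol\alpha_{\mathfrak u}}(|\mathbf m_{\mathfrak u}|+1)!\,\mathcal{S}(\boldsymbol\alpha_{\mathfrak u},\mathbf m_{\mathfrak u})\prod_{j\in\mathfrak u}b_j^{m_j}.$$ Here sums and maxima over $\mathfrak u$ range over all subsets $\mathfrak u\subseteq\{1,\dots,s\}$.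
   Context: For $\boldsymbol\nu\in\mathbb{N}_0^s$: $|\boldsymbol\nu|=\sum_j\nu_j$, $\partial^{\boldsymbol\nu}=\prod_j(\partial/\partial y_j)^{\nu_j}$, $\mathbf b^{\boldsymbol\nu}=\prod_jb_j^{\nu_j}$, $\le$ is componentwise. $\mathcal{S}(n,k)$ is the Stirling number of the second kind ($\mathcal{S}(n,0)=\delta_{n,0}$, $\mathcal{S}(n,k)=0$ for $k>n$, $\mathcal{S}(n,k)=\frac1{k!}\sum_{i=0}^k(-1)^{k-i}\binom ki i^n$ otherwise), $\mathcal{S}(\boldsymbol\nu,\mathbf m)=\prod_j\mathcal{S}(\nu_j,m_j)$. For $\mathfrak u\subseteq\{1,\dots,s\}$: $\boldsymbol\alpha_{\mathfrak u}=(\alpha,\dots,\alpha)\in\mathbb{N}_0^{\mathfrak u}$, $\mathbf m_{\mathfrak u}\in\mathbb{N}_0^{\mathfrak u}$, $|\mathbf m_{\mathfrak u}|=\sum_{j\in\mathfrak u}m_j$, $\mathcal{S}(\boldsymbol\alpha_{\mathfrak u},\mathbf m_{\mathfrak u})=\prod_{j\in\mathfrak u}\mathcal{S}(\alpha,m_j)$, $\partial^{\boldsymbol\alpha_{\mathfrak u}}=\prod_{j\in\mathfrak u}(\partial/\partial y_j)^\alpha$. For sufficiently smooth $F:[0,1]^s\to\mathbb{R}$, $\|F\|^2_{\mathcal{W}_{\alpha,\boldsymbol\gamma}}:=\sum_{\mathfrak u}\frac1{\gamma_{\mathfrak u}}\int_{[0,1]^{|\mathfrak u|}}\big|\int_{[0,1]^{s-|\mathfrak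 u|}}\partial^{\boldsymbol\alpha_{\mathfrak u}}F(\mathbf y)\,d\mathbf y_{\{1:s\}\setminus\mathfrak u}\big|^2d\mathbf y_{\mathfrak u}$ (for $\alpha=1$ this is the unanchored weighted Sobolev norm). $\|\cdot\|_{\mathcal{K}_{\alpha,\boldsymbol\gamma}}$ is the norm of the non-Hilbert weighted Korobov space of one-periodic functions, which satisfies for every sufficiently smooth one-periodic $F$: $\|F\|_{\mathcal{K}_{\alpha,\boldsymbol\gamma}}\le\max_{\mathfrak u}\frac1{\gamma_{\mathfrak u}}\int_{[0,1]^{|\mathfrak u|}}\big|\int_{[0,1]^{s-|\mathfrak u|}}\partial^{\boldsymbol\alpha_{\mathfrak u}}F(\mathbf y)\,d\mathbf y_{\{1:s\}\setminus\mathfrak u}\big|d\mathbf y_{\mathfrak u}$. *)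

theory Defs
  imports "HOL-Analysis.Analysis" "HOL-Combinatorics.Stirling"
begin

(* Conventions: coordinates of y in [0,1]^s are indexed 0..s-1 (paper: 1..s);
   points are extensional functions nat => real (undefined outside {..<s}). *)

definition cube :: "nat \<Rightarrow> (nat \<Rightarrow> real) set" where
  "cube s = PiE {..<s} (\<lambda>_. {0..1})"

definition real_space :: "nat \<Rightarrow> (nat \<Rightarrow> real) set" where
  "real_space s = PiE {..<s} (\<lambda>_. UNIV)"

(* partial derivative in coordinate j, taken within the interval I (I = {0..1} for
   functions on the cube, I = UNIV for functions on all of R^s) *)
definition dpartial :: "real set \<Rightarrow> nat \<Rightarrow> ((nat \<Rightarrow> real) \<Rightarrow> real) \<Rightarrow> (nat \<Rightarrow> real) \<Rightarrow> real" where
  "dpartial I j F y = vector_derivative (\<lambda>t. F (y(j := t))) (at (y j) within I)"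

definition diter :: "real set \<Rightarrow> nat list \<Rightarrow> ((nat \<Rightarrow> real) \<Rightarrow> real) \<Rightarrow> (nat \<Rightarrow> real) \<Rightarrow> real" where
  "diter I js F = foldr (dpartial I) js F"

definition dlist :: "nat \<Rightarrow> (nat \<Rightarrow> nat) \<Rightarrow> nat list" where
  "dlist s \<nu> = concat (map (\<lambda>j. replicate (\<nu> j) j) [0..<s])"

definition dmulti :: "real set \<Rightarrow> nat \<Rightarrow> (nat \<Rightarrow> nat) \<Rightarrow> ((nat \<Rightarrow> real) \<Rightarrow> real) \<Rightarrow> (nat \<Rightarrow> real) \<Rightarrow> real" where
  "dmulti I s \<nu> F = diter I (dlist s \<nu>) F"

definition smooth_on :: "real set \<Rightarrow> nat \<Rightarrow> ((nat \<Rightarrow> real) \<Rightarrow> real) \<Rightarrow> bool" where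
  "smooth_on I s F \<longleftrightarrow>
     (\<forall>js. set js \<subseteq> {..<s} \<longrightarrow>
       (\<forall>j<s. \<forall>y\<in>PiE {..<s} (\<lambda>_. I).
          ((\<lambda>t. diter I js F (y(j := t))) has_vector_derivative
              dpartial I j (diter I js F) y) (at (y j) within I)))"

definition mabs :: "nat \<Rightarrow> (nat \<Rightarrow> nat) \<Rightarrow> nat" where
  "mabs s \<nu> = (\<Sum>j<s. \<nu> j)"

definition bpow :: "nat \<Rightarrow> (nat \<Rightarrow> real) \<Rightarrow> (nat \<Rightarrow> nat) \<Rightarrow> real" where
  "bpow s b \<nu> = (\<Prod>j<s. b j ^ \<nu> j)"

definition stirling_multi :: "nat \<Rightarrow> (nat \<Rightarrow> nat) \<Rightarrow> (nat \<Rightarrow> nat) \<Rightarrow> real" where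
  "stirling_multi s \<nu> m = (\<Prod>j<s. real (Stirling (\<nu> j) (m j)))"

definition per_bound :: "nat \<Rightarrow> (nat \<Rightarrow> real) \<Rightarrow> (nat \<Rightarrow> nat) \<Rightarrow> real" where
  "per_bound s b \<nu> = (\<Sum>m\<in>PiE {..<s} (\<lambda>j. {0..\<nu> j}).
       fact (mabs s m) * bpow s b m * stirling_multi s \<nu> m)"

definition unitI :: "real measure" where
  "unitI = restrict_space lborel {0..1}"

definition alpha_u :: "nat \<Rightarrow> nat set \<Rightarrow> nat \<Rightarrow> nat" where
  "alpha_u \<alpha> u = (\<lambda>j. if j \<in> u then \<alpha> else 0)"

definition sob_sq :: "nat \<Rightarrow> nat \<Rightarrow> (nat set \<Rightarrow> real) \<Rightarrow> ((nat \<Rightarrow> real) \<Rightarrow> real) \<Rightarrow> real" where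
  "sob_sq s \<alpha> \<gamma> F = (\<Sum>u\<in>Pow {..<s}. (1 / \<gamma> u) *
     (\<integral>yu. (\<integral>yv. dmulti {0..1} s (alpha_u \<alpha> u) F (merge u ({..<s} - u) (yu, yv))
                 \<partial>(PiM ({..<s} - u) (\<lambda>_. unitI))) ^ 2 \<partial>(PiM u (\<lambda>_. unitI))))"

definition fourier_coeff :: "nat \<Rightarrow> ((nat \<Rightarrow> real) \<Rightarrow> real) \<Rightarrow> (nat \<Rightarrow> int) \<Rightarrow> complex" where
  "fourier_coeff s F h = (\<integral>y. complex_of_real (F y) *
       cis (- 2 * pi * (\<Sum>j<s. real_of_int (h j) * y j)) \<partial>(PiM {..<s} (\<lambda>_. unitI)))"

definition supp_int :: "nat \<Rightarrow> (nat \<Rightarrow> int) \<Rightarrow> nat set" where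
  "supp_int s h = {j\<in>{..<s}. h j \<noteq> 0}"

definition r_alpha :: "nat \<Rightarrow> nat \<Rightarrow> (nat set \<Rightarrow> real) \<Rightarrow> (nat \<Rightarrow> int) \<Rightarrow> real" where
  "r_alpha s \<alpha> \<gamma> h = (\<Prod>j\<in>supp_int s h. real_of_int \<bar>h j\<bar> ^ \<alpha>) / \<gamma> (supp_int s h)"

definition korobov_norm :: "nat \<Rightarrow> nat \<Rightarrow> (nat set \<Rightarrow> real) \<Rightarrow> ((nat \<Rightarrow> real) \<Rightarrow> real) \<Rightarrow> real" where
  "korobov_norm s \<alpha> \<gamma> F =
     (SUP h\<in>PiE {..<s} (\<lambda>_. UNIV). cmod (fourier_coeff s F h) * r_alpha s \<alpha> \<gamma> h)"

(* network: layer 0 uses input map inp (identity or sin(2 pi .)) *)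
primrec net :: "(real \<Rightarrow> real) \<Rightarrow> (nat \<Rightarrow> nat \<Rightarrow> nat \<Rightarrow> real) \<Rightarrow> (nat \<Rightarrow> nat \<Rightarrow> real)
                 \<Rightarrow> (nat \<Rightarrow> nat) \<Rightarrow> (real \<Rightarrow> real) \<Rightarrow> nat \<Rightarrow> (nat \<Rightarrow> real) \<Rightarrow> nat \<Rightarrow> real" where
  "net \<sigma> W v d inp 0 y = (\<lambda>p. (\<Sum>j<d 0. W 0 p j * inp (y j)) + v 0 p)"
| "net \<sigma> W v d inp (Suc l) y =
     (\<lambda>p. (\<Sum>q<d (Suc l). W (Suc l) p q * \<sigma> (net \<sigma> W v d inp l y q)) + v (Suc l) p)"

definition mat_inf_norm :: "(nat \<Rightarrow> nat \<Rightarrow> nat \<Rightarrow> real) \<Rightarrow> (nat \<Rightarrow> nat) \<Rightarrow> nat \<Rightarrow> real" where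
  "mat_inf_norm W d l = Max ((\<lambda>p. \<Sum>q<d l. \<bar>W l p q\<bar>) ` {..<d (Suc l)})"

definition beta :: "(nat \<Rightarrow> nat \<Rightarrow> nat \<Rightarrow> real) \<Rightarrow> (nat \<Rightarrow> nat) \<Rightarrow> nat \<Rightarrow> real" where
  "beta W d j = Max ((\<lambda>p. \<bar>W 0 p j\<bar>) ` {..<d 1})"

definition Pk :: "real \<Rightarrow> real \<Rightarrow> (nat \<Rightarrow> real) \<Rightarrow> nat \<Rightarrow> real" where
  "Pk \<xi> \<tau> R k = (\<Prod>t\<in>{1..k}. \<xi> * \<tau> * R t)"

definition SL :: "real \<Rightarrow> real \<Rightarrow> (nat \<Rightarrow> real) \<Rightarrow> nat \<Rightarrow> real" where
  "SL \<xi> \<tau> R L = \<tau> * (\<Sum>k<L. Pk \<xi> \<tau> R k)"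

definition net_sup :: "nat \<Rightarrow> nat \<Rightarrow> ((nat \<Rightarrow> real) \<Rightarrow> nat \<Rightarrow> real) \<Rightarrow> real" where
  "net_sup s N G = (SUP y\<in>cube s. Max ((\<lambda>p. \<bar>G y p\<bar>) ` {..<N}))"

end

theory Submission
  imports Defs "HOL-Probability.Infinite_Product_Measure"
    "HOL-Computational_Algebra.Formal_Power_Series" "HOL-Library.Sublist"
begin

text \<open>
  Mixed derivatives are compared with the derivatives at the origin of \<open>f (\<Sum>j. b\<^sub>j x\<^sub>j)\<close> in the
  non-periodic case and of \<open>f (\<Sum>j. b\<^sub>j (exp (2\<pi> x\<^sub>j) - 1))\<close> in the periodic one, where \<open>f\<close> is a
  univariate power series. Such majorants multiply under the Leibniz rule, and if \<open>g\<close> is majorised by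
  \<open>f\<close> with \<open>f 0 = 0\<close>, then \<open>\<sigma> \<circ> g\<close> is majorised by \<open>\<xi> / (1 - \<tau> f)\<close>. Hence, up to additive constants,
  layer \<open>l\<close> of the network is majorised by the Moebius function \<open>P\<^sub>l t / (S\<^sub>L - S\<^sub>l t)\<close>. The output is
  then majorised by \<open>C / (1 - t)\<close> and the squared error by \<open>4 C\<^sup>2 / (1 - t)\<^sup>2\<close>. The Stirling numbers
  are the Taylor coefficients of the powers of \<open>exp x - 1\<close>. The Sobolev norms are bounded by the suprema
  of the derivatives, and the Korobov norm by integrating the Fourier coefficients by parts.\<close>

section \<open>Iterated partial derivatives\<close>

locale product_domain =
  fixes I :: "real set" and s :: nat
  assumes at_within_nontrivial: "t \<in> I \<Longrightarrow> at t within I \<noteq> bot"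
begin

abbreviation dom :: "(nat \<Rightarrow> real) set" where
  "dom \<equiv> PiE {..<s} (\<lambda>_. I)"

abbreviation smooth :: "((nat \<Rightarrow> real) \<Rightarrow> real) \<Rightarrow> bool" where
  "smooth \<equiv> smooth_on I s"

definition partials :: "nat list \<Rightarrow> ((nat \<Rightarrow> real) \<Rightarrow> real) \<Rightarrow> (nat \<Rightarrow> real) \<Rightarrow> real" where
  "partials js F = fold (dpartial I) js F"

lemma partials_Nil [simp]: "partials [] F = F"
  and partials_Cons [simp]: "partials (j # js) F = partials js (dpartial I j F)"
  by (simp_all add: partials_def)

lemma diter_eq_partials: "diter I js F = partials (rev js) F"
  by (simp add: diter_def partials_def foldr_conv_fold)

definition has_partial_deriv :: "nat \<Rightarrow> ((nat \<Rightarrow> real) \<Rightarrow> real) \<Rightarrow> ((nat \<Rightarrow> real) \<Rightarrow> real) \<Rightarrow> bool" where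
  "has_partial_deriv j F F' \<longleftrightarrow>
    (\<forall>y\<in>dom. ((\<lambda>t. F (y(j := t))) has_real_derivative F' y) (at (y j) within I))"

primrec differentiable_upto :: "nat \<Rightarrow> ((nat \<Rightarrow> real) \<Rightarrow> real) \<Rightarrow> bool" where
  "differentiable_upto 0 F = True"
| "differentiable_upto (Suc n) F =
    (\<forall>j<s. \<exists>F'. has_partial_deriv j F F' \<and> differentiable_upto n F')"

lemma dom_nth: "y \<in> dom \<Longrightarrow> j < s \<Longrightarrow> y j \<in> I"
  by auto

lemma dom_upd: "y \<in> dom \<Longrightarrow> j < s \<Longrightarrow> t \<in> I \<Longrightarrow> y(j := t) \<in> dom"
  by (auto simp: PiE_iff extensional_def)

lemma has_partial_derivD:
  assumes "has_partial_deriv j F F'" "y \<in> dom" "j < s" "t \<in> I"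
  shows "((\<lambda>t. F (y(j := t))) has_real_derivative F' (y(j := t))) (at t within I)"
proof -
  have "((\<lambda>t'. F ((y(j := t))(j := t'))) has_real_derivative F' (y(j := t)))
      (at ((y(j := t)) j) within I)"
    using assms dom_upd[OF assms(2-4)] unfolding has_partial_deriv_def by blast
  then show ?thesis by simp
qed

lemma has_partial_deriv_cong:
  assumes "has_partial_deriv j F F'" "j < s"
    and "\<And>y. y \<in> dom \<Longrightarrow> F y = G y" "\<And>y. y \<in> dom \<Longrightarrow> F' y = G' y"
  shows "has_partial_deriv j G G'"
  unfolding has_partial_deriv_def
proof
  fix y assume y: "y \<in> dom"
  then have "((\<lambda>t. F (y(j := t))) has_real_derivative G' y) (at (y j) within I)"
    using assms(1,4) by (simp add: has_partial_deriv_def)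
  then show "((\<lambda>t. G (y(j := t))) has_real_derivative G' y) (at (y j) within I)"
    by (rule has_field_derivative_transform_within[OF _ zero_less_one])
      (use assms(3)[OF dom_upd[OF y assms(2)]] dom_nth[OF y assms(2)] in auto)
qed

lemma dpartial_eqI:
  assumes "has_partial_deriv j F F'" "y \<in> dom" "j < s"
  shows "dpartial I j F y = F' y"
proof -
  have "((\<lambda>t. F (y(j := t))) has_vector_derivative F' y) (at (y j) within I)"
    using assms(1,2)
    by (simp add: has_partial_deriv_def has_real_derivative_iff_has_vector_derivative)
  with at_within_nontrivial[OF dom_nth[OF assms(2,3)]] show ?thesis
    unfolding dpartial_def by (rule vector_derivative_within)
qed

lemma differentiable_upto_cong:
  assumes "differentiable_upto n F" "\<And>y. y \<in> dom \<Longrightarrow> F y = G y"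
  shows "differentiable_upto n G"
proof (cases n)
  case (Suc m)
  show ?thesis
    unfolding Suc differentiable_upto.simps
  proof (intro allI impI)
    fix j assume j: "j < s"
    then obtain F' where F': "has_partial_deriv j F F'" "differentiable_upto m F'"
      using assms(1) Suc by auto
    then show "\<exists>F'. has_partial_deriv j G F' \<and> differentiable_upto m F'"
      using has_partial_deriv_cong[OF F'(1) j assms(2) refl] by blast
  qed
qed simp

lemma differentiable_upto_dpartial:
  assumes "differentiable_upto (Suc n) F" "j < s"
  shows "has_partial_deriv j F (dpartial I j F)" and "differentiable_upto n (dpartial I j F)"
proof -
  obtain F' where F': "has_partial_deriv j F F'" "differentiable_upto n F'"
    using assms by auto
  have eq: "F' y = dpartial I j F y" if "y \<in> dom" for y
    using dpartial_eqI[OF F'(1) that assms(2)] by simp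
  show "has_partial_deriv j F (dpartial I j F)"
    using has_partial_deriv_cong[OF F'(1) assms(2) refl eq] .
  show "differentiable_upto n (dpartial I j F)"
    using differentiable_upto_cong[OF F'(2) eq] .
qed

lemma differentiable_upto_SucD: "differentiable_upto (Suc n) F \<Longrightarrow> differentiable_upto n F"
proof (induction n arbitrary: F)
  case (Suc n)
  then show ?case unfolding differentiable_upto.simps(2) by blast
qed simp

lemma smooth_iff_partials:
  "smooth F \<longleftrightarrow> (\<forall>js j. set js \<subseteq> {..<s} \<longrightarrow> j < s \<longrightarrow>
    has_partial_deriv j (partials js F) (dpartial I j (partials js F)))"
proof -
  have all_rev: "(\<forall>js. Q js) \<longleftrightarrow> (\<forall>js. Q (rev js))" for Q :: "nat list \<Rightarrow> bool"
    by (metis rev_rev_ident)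
  show ?thesis
    unfolding smooth_on_def has_partial_deriv_def diter_eq_partials
      has_real_derivative_iff_has_vector_derivative
    by (subst (2) all_rev) simp
qed

lemma smooth_imp_has_partial_deriv:
  "smooth F \<Longrightarrow> j < s \<Longrightarrow> has_partial_deriv j F (dpartial I j F)"
  unfolding smooth_iff_partials by (drule spec[of _ "[]"]) simp

lemma smooth_dpartial:
  assumes "smooth F" "j < s"
  shows "smooth (dpartial I j F)"
  unfolding smooth_iff_partials
proof (intro allI impI)
  fix js i assume "set js \<subseteq> {..<s}" "i < s"
  with assms show "has_partial_deriv i (partials js (dpartial I j F))
      (dpartial I i (partials js (dpartial I j F)))"
    unfolding smooth_iff_partials by (auto dest!: spec[of _ "j # js"])
qed

lemma smooth_iff_differentiable_upto: "smooth F \<longleftrightarrow> (\<forall>n. differentiable_upto n F)"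
proof
  have "differentiable_upto n F" if "smooth F" for n F
    using that
  proof (induction n arbitrary: F)
    case (Suc n)
    then show ?case
      unfolding differentiable_upto.simps
      by (blast intro: smooth_imp_has_partial_deriv smooth_dpartial)
  qed simp
  then show "smooth F \<Longrightarrow> \<forall>n. differentiable_upto n F" by blast
next
  have "\<forall>n. differentiable_upto n (partials js F)"
    if "\<forall>n. differentiable_upto n F" "set js \<subseteq> {..<s}" for js F
    using that
  proof (induction js arbitrary: F)
    case (Cons j js)
    then have "\<forall>n. differentiable_upto n (dpartial I j F)"
      using differentiable_upto_dpartial(2)[of _ F j] by simp
    then show ?case using Cons by simp
  qed simp
  then show "\<forall>n. differentiable_upto n F \<Longrightarrow> smooth F"
    unfolding smooth_iff_partials by (blast intro: differentiable_upto_dpartial(1))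
qed

lemma has_partial_deriv_const: "has_partial_deriv j (\<lambda>y. c) (\<lambda>y. 0)"
  by (simp add: has_partial_deriv_def)

lemma has_partial_deriv_add:
  "has_partial_deriv j F F' \<Longrightarrow> has_partial_deriv j G G' \<Longrightarrow>
    has_partial_deriv j (\<lambda>y. F y + G y) (\<lambda>y. F' y + G' y)"
  unfolding has_partial_deriv_def by (intro ballI DERIV_add) blast+

lemma has_partial_deriv_cmult:
  "has_partial_deriv j F F' \<Longrightarrow> has_partial_deriv j (\<lambda>y. c * F y) (\<lambda>y. c * F' y)"
  unfolding has_partial_deriv_def by (intro ballI DERIV_cmult) blast

lemma has_partial_deriv_mult:
  assumes "has_partial_deriv j F F'" "has_partial_deriv j G G'"
  shows "has_partial_deriv j (\<lambda>y. F y * G y) (\<lambda>y. F' y * G y + F y * G' y)"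
  unfolding has_partial_deriv_def
proof
  fix y assume "y \<in> dom"
  with assms have "((\<lambda>t. F (y(j := t))) has_real_derivative F' y) (at (y j) within I)"
    "((\<lambda>t. G (y(j := t))) has_real_derivative G' y) (at (y j) within I)"
    unfolding has_partial_deriv_def by blast+
  from DERIV_mult[OF this]
  show "((\<lambda>t. F (y(j := t)) * G (y(j := t))) has_real_derivative F' y * G y + F y * G' y)
      (at (y j) within I)" by (simp add: mult.commute)
qed

lemma has_partial_deriv_compose:
  assumes "\<And>x. (h has_real_derivative h' x) (at x)" "has_partial_deriv j F F'"
  shows "has_partial_deriv j (\<lambda>y. h (F y)) (\<lambda>y. h' (F y) * F' y)"
  unfolding has_partial_deriv_def
proof
  fix y assume "y \<in> dom"
  then have "((\<lambda>t. F (y(j := t))) has_real_derivative F' y) (at (y j) within I)"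
    using assms(2) by (simp add: has_partial_deriv_def)
  from DERIV_chain2[OF assms(1) this]
  show "((\<lambda>t. h (F (y(j := t)))) has_real_derivative h' (F y) * F' y) (at (y j) within I)"
    by simp
qed

lemma has_partial_deriv_coordinate:
  assumes "\<And>x. (h has_real_derivative h' x) (at x)"
  shows "has_partial_deriv j (\<lambda>y. h (y i)) (\<lambda>y. if j = i then h' (y i) else 0)"
  unfolding has_partial_deriv_def
  by (cases "j = i") (auto intro: has_field_derivative_at_within[OF assms])

lemma differentiable_upto_const: "differentiable_upto n (\<lambda>y. c)"
  by (induction n arbitrary: c) (auto intro: has_partial_deriv_const)

lemma differentiable_upto_add:
  "differentiable_upto n F \<Longrightarrow> differentiable_upto n G \<Longrightarrow> differentiable_upto n (\<lambda>y. F y + G y)"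
proof (induction n arbitrary: F G)
  case (Suc n)
  show ?case
    unfolding differentiable_upto.simps
  proof (intro allI impI)
    fix j assume "j < s"
    with Suc.prems obtain F' G' where "has_partial_deriv j F F'" "differentiable_upto n F'"
      "has_partial_deriv j G G'" "differentiable_upto n G'"
      unfolding differentiable_upto.simps by blast
    then have "has_partial_deriv j (\<lambda>y. F y + G y) (\<lambda>y. F' y + G' y)"
      "differentiable_upto n (\<lambda>y. F' y + G' y)"
      by (simp_all add: has_partial_deriv_add Suc.IH)
    then show "\<exists>H'. has_partial_deriv j (\<lambda>y. F y + G y) H' \<and> differentiable_upto n H'" by blast
  qed
qed simp

lemma differentiable_upto_mult:
  "differentiable_upto n F \<Longrightarrow> differentiable_upto n G \<Longrightarrow> differentiable_upto n (\<lambda>y. F y * G y)"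
proof (induction n arbitrary: F G)
  case (Suc n)
  note lower = differentiable_upto_SucD[OF Suc.prems(1)] differentiable_upto_SucD[OF Suc.prems(2)]
  show ?case
    unfolding differentiable_upto.simps
  proof (intro allI impI)
    fix j assume "j < s"
    with Suc.prems obtain F' G' where "has_partial_deriv j F F'" "differentiable_upto n F'"
      "has_partial_deriv j G G'" "differentiable_upto n G'"
      unfolding differentiable_upto.simps by blast
    with lower have "has_partial_deriv j (\<lambda>y. F y * G y) (\<lambda>y. F' y * G y + F y * G' y)"
      "differentiable_upto n (\<lambda>y. F' y * G y + F y * G' y)"
      by (simp_all add: has_partial_deriv_mult differentiable_upto_add Suc.IH)
    then show "\<exists>H'. has_partial_deriv j (\<lambda>y. F y * G y) H' \<and> differentiable_upto n H'" by blast
  qed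
qed simp

lemma smooth_const: "smooth (\<lambda>y. c)"
  and smooth_add: "smooth F \<Longrightarrow> smooth G \<Longrightarrow> smooth (\<lambda>y. F y + G y)"
  and smooth_mult: "smooth F \<Longrightarrow> smooth G \<Longrightarrow> smooth (\<lambda>y. F y * G y)"
  by (simp_all add: smooth_iff_differentiable_upto differentiable_upto_const
      differentiable_upto_add differentiable_upto_mult)

lemma smooth_cmult: "smooth F \<Longrightarrow> smooth (\<lambda>y. c * F y)"
  by (intro smooth_mult smooth_const)

lemma smooth_diff:
  assumes "smooth F" "smooth G"
  shows "smooth (\<lambda>y. F y - G y)"
  using smooth_add[OF assms(1) smooth_cmult[OF assms(2), of "-1"]] by simp

lemma smooth_sum:
  assumes "finite A" "\<And>i. i \<in> A \<Longrightarrow> smooth (F i)"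
  shows "smooth (\<lambda>y. \<Sum>i\<in>A. F i y)"
  using assms by (induction rule: finite_induct) (simp_all add: smooth_const smooth_add)

lemma smooth_coordinate: "smooth (\<lambda>y. y i)"
proof -
  have "has_partial_deriv j (\<lambda>y. y i) (\<lambda>y. of_bool (j = i))" for j
    using has_partial_deriv_coordinate[of "\<lambda>t. t" "\<lambda>_. 1" j i] by (simp add: of_bool_def)
  then have "differentiable_upto n (\<lambda>y. y i)" for n
    by (cases n) (auto intro!: exI differentiable_upto_const)
  then show ?thesis by (simp add: smooth_iff_differentiable_upto)
qed

end

definition smooth_fun :: "(real \<Rightarrow> real) \<Rightarrow> bool" where
  "smooth_fun h \<longleftrightarrow> (\<forall>n x. ((deriv ^^ n) h has_real_derivative (deriv ^^ Suc n) h x) (at x))"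

lemma smooth_funD: "smooth_fun h \<Longrightarrow> ((deriv ^^ n) h has_real_derivative (deriv ^^ Suc n) h x) (at x)"
  unfolding smooth_fun_def by blast

lemma higher_deriv_eqI:
  fixes h :: "nat \<Rightarrow> real \<Rightarrow> real"
  assumes "\<And>n x. (h n has_real_derivative h (Suc n) x) (at x)"
  shows "(deriv ^^ n) (h 0) = h n"
proof (induction n)
  case (Suc n)
  have "deriv (h n) = h (Suc n)" using DERIV_imp_deriv[OF assms] by (simp add: fun_eq_iff)
  with Suc show ?case by simp
qed simp

lemma smooth_funI:
  assumes "\<And>n x. (h n has_real_derivative h (Suc n) x) (at x)"
  shows "smooth_fun (h 0)"
  unfolding smooth_fun_def higher_deriv_eqI[of h, OF assms] using assms by blast

context product_domain
begin

lemma smooth_compose: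
  assumes "smooth_fun h" "smooth F"
  shows "smooth (\<lambda>y. (deriv ^^ k) h (F y))"
proof -
  have "differentiable_upto n (\<lambda>y. (deriv ^^ k) h (F y))" for n
  proof (induction n arbitrary: k)
    case (Suc n)
    have "has_partial_deriv j (\<lambda>y. (deriv ^^ k) h (F y))
        (\<lambda>y. (deriv ^^ Suc k) h (F y) * dpartial I j F y)"
      "differentiable_upto n (\<lambda>y. (deriv ^^ Suc k) h (F y) * dpartial I j F y)" if "j < s" for j
      using has_partial_deriv_compose[OF smooth_funD[OF assms(1)]
          smooth_imp_has_partial_deriv[OF assms(2) that]]
        differentiable_upto_mult[OF Suc, of "dpartial I j F"] smooth_dpartial[OF assms(2) that]
      unfolding smooth_iff_differentiable_upto by blast+
    then show ?case unfolding differentiable_upto.simps by blast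
  qed simp
  then show ?thesis by (simp add: smooth_iff_differentiable_upto)
qed

lemma partials_cong:
  assumes "smooth F" "\<And>y. y \<in> dom \<Longrightarrow> F y = G y" "set js \<subseteq> {..<s}" "y \<in> dom"
  shows "partials js F y = partials js G y"
  using assms
proof (induction js arbitrary: F G)
  case (Cons j js)
  have j: "j < s" using Cons.prems(3) by simp
  have F': "has_partial_deriv j F (dpartial I j F)"
    by (rule smooth_imp_has_partial_deriv[OF Cons.prems(1) j])
  have "has_partial_deriv j G (dpartial I j F)"
    using has_partial_deriv_cong[OF F' j Cons.prems(2) refl] .
  then have "partials js (dpartial I j F) y = partials js (dpartial I j G) y"
    using Cons.prems j by (intro Cons.IH smooth_dpartial dpartial_eqI[symmetric]) auto
  then show ?case by simp
qed auto

lemma partials_Cons_eq: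
  assumes "has_partial_deriv j F F'" "smooth F'" "set (j # js) \<subseteq> {..<s}" "y \<in> dom"
  shows "partials (j # js) F y = partials js F' y"
  unfolding partials_Cons
  using assms by (intro partials_cong[symmetric] dpartial_eqI[symmetric]) auto

lemma partials_add:
  assumes "smooth F" "smooth G" "set js \<subseteq> {..<s}" "y \<in> dom"
  shows "partials js (\<lambda>y. F y + G y) y = partials js F y + partials js G y"
  using assms
proof (induction js arbitrary: F G)
  case (Cons j js)
  have "partials (j # js) (\<lambda>y. F y + G y) y
      = partials js (\<lambda>y. dpartial I j F y + dpartial I j G y) y"
    using Cons.prems
    by (intro partials_Cons_eq has_partial_deriv_add smooth_imp_has_partial_deriv smooth_add
        smooth_dpartial) auto
  also have "\<dots> = partials js (dpartial I j F) y + partials js (dpartial I j G) y"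
    using Cons.prems by (intro Cons.IH smooth_dpartial) auto
  finally show ?case by simp
qed simp

lemma partials_cmult:
  assumes "smooth F" "set js \<subseteq> {..<s}" "y \<in> dom"
  shows "partials js (\<lambda>y. c * F y) y = c * partials js F y"
  using assms
proof (induction js arbitrary: F)
  case (Cons j js)
  have "partials (j # js) (\<lambda>y. c * F y) y = partials js (\<lambda>y. c * dpartial I j F y) y"
    using Cons.prems
    by (intro partials_Cons_eq has_partial_deriv_cmult smooth_imp_has_partial_deriv smooth_cmult
        smooth_dpartial) auto
  also have "\<dots> = c * partials js (dpartial I j F) y"
    using Cons.prems by (intro Cons.IH smooth_dpartial) auto
  finally show ?case by simp
qed simp

lemma partials_const:
  assumes "js \<noteq> []" "set js \<subseteq> {..<s}" "y \<in> dom"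
  shows "partials js (\<lambda>y. c) y = 0"
  using assms
proof (induction js arbitrary: c)
  case (Cons j js)
  then have "partials (j # js) (\<lambda>y. c) y = partials js (\<lambda>y. 0) y"
    by (intro partials_Cons_eq has_partial_deriv_const smooth_const) auto
  then show ?case using Cons by (cases "js = []") auto
qed simp

lemma partials_sum:
  assumes "finite A" "\<And>i. i \<in> A \<Longrightarrow> smooth (F i)" "set js \<subseteq> {..<s}" "y \<in> dom"
  shows "partials js (\<lambda>y. \<Sum>i\<in>A. F i y) y = (\<Sum>i\<in>A. partials js (F i) y)"
  using assms(1,2)
proof (induction rule: finite_induct)
  case empty
  then show ?case using partials_const[of js y 0] assms(3,4) by (cases "js = []") auto
next
  case (insert i A)
  then show ?case using assms(3,4) by (simp add: partials_add smooth_sum)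
qed

lemma partials_affine:
  assumes "finite A" "\<And>q. q \<in> A \<Longrightarrow> smooth (F q)" "js \<noteq> []" "set js \<subseteq> {..<s}" "y \<in> dom"
  shows "partials js (\<lambda>y. (\<Sum>q\<in>A. a q * F q y) + e) y = (\<Sum>q\<in>A. a q * partials js (F q) y)"
  using assms
  by (simp add: partials_add partials_sum partials_cmult partials_const smooth_sum smooth_cmult
      smooth_const)

lemma partials_coordinate:
  assumes "smooth_fun h" "set js \<subseteq> {..<s}" "y \<in> dom"
  shows "partials js (\<lambda>y. h (y i)) y = (if set js \<subseteq> {i} then (deriv ^^ length js) h (y i) else 0)"
proof -
  have "partials js (\<lambda>y. (deriv ^^ n) h (y i)) y
      = (if set js \<subseteq> {i} then (deriv ^^ (n + length js)) h (y i) else 0)" for n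
    using assms(2)
  proof (induction js arbitrary: n)
    case (Cons j js)
    let ?h' = "\<lambda>y. if j = i then (deriv ^^ Suc n) h (y i) else 0"
    have "smooth ?h'"
      using smooth_compose[OF assms(1) smooth_coordinate, of "Suc n" i] smooth_const
      by (cases "j = i") simp_all
    then have "partials (j # js) (\<lambda>y. (deriv ^^ n) h (y i)) y = partials js ?h' y"
      using Cons.prems assms(3)
      by (intro partials_Cons_eq has_partial_deriv_coordinate smooth_funD assms(1))
    also have "\<dots> = (if set (j # js) \<subseteq> {i} then (deriv ^^ (n + length (j # js))) h (y i) else 0)"
    proof (cases "j = i")
      case True
      then show ?thesis using Cons.IH[of "Suc n"] Cons.prems by simp
    next
      case False
      then show ?thesis using partials_const[of js y 0] Cons.prems assms(3)
        by (cases "js = []") auto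
    qed
    finally show ?case .
  qed simp
  from this[of 0] show ?thesis by simp
qed

end

lemma product_domain_UNIV: "product_domain UNIV"
  by unfold_locales simp

lemma product_domain_atLeastAtMost: "a < b \<Longrightarrow> product_domain {a..b}"
  by unfold_locales (simp add: trivial_limit_within)

section \<open>Majorants\<close>

text \<open>\<open>leibniz_sum A B js\<close> is the sum of \<open>A l * B l'\<close> over all splittings of \<open>js\<close> into complementary
  subsequences \<open>l\<close> and \<open>l'\<close>.\<close>

primrec leibniz_sum :: "('a list \<Rightarrow> real) \<Rightarrow> ('a list \<Rightarrow> real) \<Rightarrow> 'a list \<Rightarrow> real" where
  "leibniz_sum A B [] = A [] * B []"
| "leibniz_sum A B (j # js) = leibniz_sum (\<lambda>l. A (j # l)) B js + leibniz_sum A (\<lambda>l. B (j # l)) js"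

lemma leibniz_sum_linear_left:
  "leibniz_sum (\<lambda>l. c * A l + d * A' l) B js = c * leibniz_sum A B js + d * leibniz_sum A' B js"
  by (induction js arbitrary: A A' B) (simp_all add: algebra_simps)

lemma leibniz_sum_linear_right:
  "leibniz_sum A (\<lambda>l. c * B l + d * B' l) js = c * leibniz_sum A B js + d * leibniz_sum A B' js"
  by (induction js arbitrary: A B B') (simp_all add: algebra_simps)

lemma (in product_domain) abs_partials_mult_le:
  assumes "smooth F" "smooth G" "set js \<subseteq> {..<s}" "y \<in> dom"
    and "\<And>l. subseq l js \<Longrightarrow> \<bar>partials l F y\<bar> \<le> A l"
    and "\<And>l. subseq l js \<Longrightarrow> \<bar>partials l G y\<bar> \<le> B l"
  shows "\<bar>partials js (\<lambda>y. F y * G y) y\<bar> \<le> leibniz_sum A B js"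
  using assms
proof (induction js arbitrary: F G A B)
  case Nil
  have "\<bar>F y\<bar> \<le> A []" "\<bar>G y\<bar> \<le> B []" using Nil(5)[of "[]"] Nil(6)[of "[]"] by auto
  then have "\<bar>F y\<bar> * \<bar>G y\<bar> \<le> A [] * B []" by (intro mult_mono) auto
  then show ?case by (simp add: abs_mult)
next
  case (Cons j js)
  let ?F' = "dpartial I j F" and ?G' = "dpartial I j G"
  have smooth': "smooth ?F'" "smooth ?G'"
    using Cons.prems by (auto intro: smooth_dpartial)
  have "partials (j # js) (\<lambda>y. F y * G y) y = partials js (\<lambda>y. ?F' y * G y + F y * ?G' y) y"
    using Cons.prems smooth'
    by (intro partials_Cons_eq has_partial_deriv_mult smooth_imp_has_partial_deriv smooth_add
        smooth_mult) auto
  also have "\<dots> = partials js (\<lambda>y. ?F' y * G y) y + partials js (\<lambda>y. F y * ?G' y) y"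
    using Cons.prems smooth' by (intro partials_add smooth_mult) auto
  finally have product_rule: "partials (j # js) (\<lambda>y. F y * G y) y = \<dots>" .
  have "\<bar>partials js (\<lambda>y. ?F' y * G y) y\<bar> \<le> leibniz_sum (\<lambda>l. A (j # l)) B js"
  proof (rule Cons.IH)
    fix l assume "subseq l js"
    then have "subseq (j # l) (j # js)" "subseq l (j # js)" by auto
    then show "\<bar>partials l ?F' y\<bar> \<le> A (j # l)" "\<bar>partials l G y\<bar> \<le> B l"
      using Cons.prems(5)[of "j # l"] Cons.prems(6)[of l] by auto
  qed (use Cons.prems smooth' in auto)
  moreover have "\<bar>partials js (\<lambda>y. F y * ?G' y) y\<bar> \<le> leibniz_sum A (\<lambda>l. B (j # l)) js"
  proof (rule Cons.IH)
    fix l assume "subseq l js"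
    then have "subseq (j # l) (j # js)" "subseq l (j # js)" by auto
    then show "\<bar>partials l F y\<bar> \<le> A l" "\<bar>partials l ?G' y\<bar> \<le> B (j # l)"
      using Cons.prems(6)[of "j # l"] Cons.prems(5)[of l] by auto
  qed (use Cons.prems smooth' in auto)
  ultimately show ?case unfolding product_rule by simp
qed

text \<open>For \<open>w \<noteq> 0\<close>, \<open>maj_deriv b w f k js\<close> is the iterated derivative at \<open>x = 0\<close> in the directions
  \<open>js\<close> of \<open>f (\<Sum>j. b\<^sub>j (exp (w x\<^sub>j) - 1) / w) \<cdot> exp (w \<Sum>j. k\<^sub>j x\<^sub>j)\<close>;
  for \<open>w = 0\<close>, of \<open>f (\<Sum>j. b\<^sub>j x\<^sub>j)\<close>.\<close>

primrec maj_deriv :: "(nat \<Rightarrow> real) \<Rightarrow> real \<Rightarrow> real fps \<Rightarrow> (nat \<Rightarrow> nat) \<Rightarrow> nat list \<Rightarrow> real" where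
  "maj_deriv b w f k [] = fps_nth f 0"
| "maj_deriv b w f k (j # js) =
    b j * maj_deriv b w (fps_deriv f) (k(j := Suc (k j))) js
        + w * real (k j) * maj_deriv b w f k js"

lemma maj_deriv_add: "maj_deriv b w (f + g) k js = maj_deriv b w f k js + maj_deriv b w g k js"
  by (induction js arbitrary: f g k) (simp_all add: algebra_simps)

lemma maj_deriv_cmult: "maj_deriv b w (fps_const c * f) k js = c * maj_deriv b w f k js"
  by (induction js arbitrary: f k) (simp_all add: distrib_left)

lemma maj_deriv_scale: "maj_deriv (\<lambda>j. c * b j) (c * w) f k js
    = c ^ length js * maj_deriv b w f k js"
  by (induction js arbitrary: f k) (simp_all add: algebra_simps)

lemma maj_deriv_nonneg:
  assumes "\<And>j. b j \<ge> 0" "w \<ge> 0" "\<And>n. fps_nth f n \<ge> 0"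
  shows "maj_deriv b w f k js \<ge> 0"
  using assms(3) by (induction js arbitrary: f k) (simp_all add: assms(1,2) fps_deriv_nth)

lemma maj_deriv_const:
  "maj_deriv b w (fps_const c) k js = c * prod_list (map (\<lambda>j. w * real (k j)) js)"
proof (induction js)
  case (Cons j js)
  have "maj_deriv b w 0 k' js = 0" for k'
    using maj_deriv_cmult[of b w 0 0 k'] by simp
  with Cons show ?case by simp
qed simp

lemma maj_deriv_X:
  "maj_deriv b w (fps_const c * fps_X) (\<lambda>_. 0) (j # js)
      = (if set js \<subseteq> {j} then c * b j * w ^ length js else 0)"
proof -
  have "prod_list (map (\<lambda>i. w * real (((\<lambda>_. 0)(j := Suc 0)) i)) js)
      = (if set js \<subseteq> {j} then w ^ length js else 0)"
    by (induction js) auto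
  then show ?thesis by (simp add: maj_deriv_const)
qed

lemma maj_deriv_add_const:
  assumes "js \<noteq> []"
  shows "maj_deriv b w (f + fps_const c) (\<lambda>_. 0) js = maj_deriv b w f (\<lambda>_. 0) js"
  using assms by (cases js) (simp_all add: maj_deriv_add)

lemma leibniz_sum_maj_deriv:
  "leibniz_sum (maj_deriv b w f k) (maj_deriv b w g m) js
      = maj_deriv b w (f * g) (\<lambda>i. k i + m i) js"
proof (induction js arbitrary: f g k m)
  case (Cons j js)
  have "leibniz_sum (maj_deriv b w f k) (maj_deriv b w g m) (j # js)
      = b j * maj_deriv b w (fps_deriv f * g) (\<lambda>i. (k(j := Suc (k j))) i + m i) js
        + w * real (k j) * maj_deriv b w (f * g) (\<lambda>i. k i + m i) js
        + (b j * maj_deriv b w (f * fps_deriv g) (\<lambda>i. k i + (m(j := Suc (m j))) i) js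
        + w * real (m j) * maj_deriv b w (f * g) (\<lambda>i. k i + m i) js)"
    by (simp only: leibniz_sum.simps maj_deriv.simps leibniz_sum_linear_left
        leibniz_sum_linear_right Cons.IH)
  also have "(\<lambda>i. (k(j := Suc (k j))) i + m i) = (\<lambda>i. k i + m i)(j := Suc (k j + m j))" by auto
  also have "(\<lambda>i. k i + (m(j := Suc (m j))) i) = (\<lambda>i. k i + m i)(j := Suc (k j + m j))" by auto
  finally show ?case
    unfolding maj_deriv.simps fps_deriv_mult maj_deriv_add of_nat_add by (simp only: algebra_simps)
qed simp

text \<open>The \<open>k\<close>-th derivative of \<open>\<xi> / (1 - \<tau> t)\<close>, composed with \<open>f\<close>.\<close>

definition geometric_deriv :: "real \<Rightarrow> real \<Rightarrow> nat \<Rightarrow> real fps \<Rightarrow> real fps" where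
  "geometric_deriv \<xi> \<tau> k f = fps_const (\<xi> * \<tau> ^ k * fact k) * inverse (1 - fps_const \<tau> * f) ^ Suc k"

lemma fps_deriv_geometric_deriv:
  assumes "fps_nth f 0 = 0"
  shows "fps_deriv (geometric_deriv \<xi> \<tau> k f) = geometric_deriv \<xi> \<tau> (Suc k) f * fps_deriv f"
proof -
  define Q where "Q = inverse (1 - fps_const \<tau> * f)"
  have Q': "fps_deriv Q = fps_const \<tau> * fps_deriv f * Q ^ 2"
    using assms by (simp add: Q_def fps_inverse_deriv)
  have const: "fps_const (\<xi> * \<tau> ^ Suc k * fact (Suc k))
      = fps_const (\<xi> * \<tau> ^ k * fact k) * fps_const (real (Suc k)) * fps_const \<tau>"
    by (simp only: fps_const_mult) (simp add: algebra_simps)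
  have "fps_deriv (geometric_deriv \<xi> \<tau> k f) = fps_const (\<xi> * \<tau> ^ k * fact k)
      * (fps_const (real (Suc k)) * (fps_const \<tau> * fps_deriv f * Q ^ 2) * Q ^ k)"
    unfolding geometric_deriv_def Q_def[symmetric] fps_deriv_mult fps_deriv_power Q' by simp
  also have "\<dots> = geometric_deriv \<xi> \<tau> (Suc k) f * fps_deriv f"
    unfolding geometric_deriv_def Q_def[symmetric] const
    by (simp only: power_Suc power2_eq_square mult_ac)
  finally show ?thesis .
qed

lemma (in product_domain) abs_partials_mult_dpartial_le:
  assumes "smooth F" "smooth G" "set (j # js) \<subseteq> {..<s}" "y \<in> dom"
    and "\<And>l. subseq l js \<Longrightarrow> \<bar>partials l F y\<bar> \<le> maj_deriv b w f (\<lambda>_. 0) l"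
    and "\<And>l. subseq l js \<Longrightarrow> \<bar>partials (j # l) G y\<bar> \<le> maj_deriv b w g (\<lambda>_. 0) (j # l)"
  shows "\<bar>partials js (\<lambda>y. F y * dpartial I j G y) y\<bar>
    \<le> b j * maj_deriv b w (f * fps_deriv g) ((\<lambda>_. 0)(j := Suc 0)) js"
proof -
  let ?e = "(\<lambda>_. 0)(j := Suc 0)"
  have "\<bar>partials js (\<lambda>y. F y * dpartial I j G y) y\<bar>
      \<le> leibniz_sum (maj_deriv b w f (\<lambda>_. 0))
        (\<lambda>l. b j * maj_deriv b w (fps_deriv g) ?e l + 0 * maj_deriv b w g (\<lambda>_. 0) l) js"
    using assms by (intro abs_partials_mult_le smooth_dpartial) auto
  also have "\<dots> = b j * maj_deriv b w (f * fps_deriv g) ?e js"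
    by (simp only: leibniz_sum_linear_right leibniz_sum_maj_deriv) (simp add: fun_upd_def)
  finally show ?thesis .
qed

lemma (in product_domain) abs_partials_compose_le:
  assumes h: "smooth_fun h" "\<And>n x. n \<ge> 1 \<Longrightarrow> \<bar>(deriv ^^ n) h x\<bar> \<le> \<xi> * \<tau> ^ n * fact n"
    and g: "smooth g" "y \<in> dom"
      "\<And>js. js \<noteq> [] \<Longrightarrow> set js \<subseteq> {..<s} \<Longrightarrow> \<bar>partials js g y\<bar> \<le> maj_deriv b w f (\<lambda>_. 0) js"
    and f: "fps_nth f 0 = 0"
    and js: "set js \<subseteq> {..<s}" "k \<ge> 1 \<or> js \<noteq> []"
  shows "\<bar>partials js (\<lambda>y. (deriv ^^ k) h (g y)) y\<bar>
      \<le> maj_deriv b w (geometric_deriv \<xi> \<tau> k f) (\<lambda>_. 0) js"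
  using js
proof (induction js arbitrary: k rule: measure_induct_rule[of length])
  case (less js)
  show ?case
  proof (cases js)
    case Nil
    then show ?thesis using less.prems(2) h(2)[of k "g y"] f
      by (simp add: geometric_deriv_def fps_power_zeroth)
  next
    case (Cons j ls)
    have j: "j < s" and ls: "set ls \<subseteq> {..<s}" using less.prems(1) Cons by auto
    let ?h' = "\<lambda>y. (deriv ^^ Suc k) h (g y)"
    have smooth': "smooth ?h'" "smooth (dpartial I j g)"
      using smooth_compose[OF h(1) g(1)] smooth_dpartial[OF g(1) j] by blast+
    have chain_rule: "partials js (\<lambda>y. (deriv ^^ k) h (g y)) y
        = partials ls (\<lambda>y. ?h' y * dpartial I j g y) y"
      unfolding Cons using j ls g(2) smooth'
      by (intro partials_Cons_eq smooth_mult
          has_partial_deriv_compose[OF smooth_funD[OF h(1)]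
              smooth_imp_has_partial_deriv[OF g(1) j]]) auto
    have "\<bar>partials ls (\<lambda>y. ?h' y * dpartial I j g y) y\<bar>
        \<le> b j * maj_deriv b w (geometric_deriv \<xi> \<tau> (Suc k) f * fps_deriv f)
            ((\<lambda>_. 0)(j := Suc 0)) ls"
    proof (rule abs_partials_mult_dpartial_le[OF smooth'(1) g(1) _ g(2)])
      fix l assume l: "subseq l ls"
      then have len: "length l < length js" using list_emb_length[OF l] Cons by simp
      have "set l \<subseteq> set ls" using list_emb_set[OF l] by blast
      with ls have l_s: "set l \<subseteq> {..<s}" by (rule subset_trans[rotated])
      show "\<bar>partials l ?h' y\<bar> \<le> maj_deriv b w (geometric_deriv \<xi> \<tau> (Suc k) f) (\<lambda>_. 0) l"
        using less.IH[OF len l_s, of "Suc k"] by simp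
      show "\<bar>partials (j # l) g y\<bar> \<le> maj_deriv b w f (\<lambda>_. 0) (j # l)"
        using l_s j by (intro g(3)) auto
    qed (use j ls in simp)
    also have "\<dots> = maj_deriv b w (geometric_deriv \<xi> \<tau> k f) (\<lambda>_. 0) js"
      by (simp add: Cons fps_deriv_geometric_deriv[OF f])
    finally show ?thesis unfolding chain_rule .
  qed
qed

section \<open>Stirling numbers\<close>

lemma sum_PiE_insert:
  assumes "j \<notin> A"
  shows "(\<Sum>m\<in>PiE (insert j A) B. h m) = (\<Sum>i\<in>B j. \<Sum>m\<in>PiE A B. h (m(j := i)))"
proof -
  have "(\<Sum>m\<in>PiE (insert j A) B. h m) = (\<Sum>x\<in>B j \<times> PiE A B. h ((\<lambda>(i, m). m(j := i)) x))"
    unfolding PiE_insert_eq by (rule sum.reindex[unfolded comp_def, OF inj_combinator[OF assms]])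
  then show ?thesis by (simp add: sum.cartesian_product case_prod_unfold)
qed

lemma fact_nth_fps_deriv_funpow:
  "fact n * fps_nth ((fps_deriv ^^ i) f) n
      = (fact (n + i) * fps_nth f (n + i) :: 'a :: {comm_semiring_1, semiring_char_0})"
proof (induction i arbitrary: n)
  case (Suc i)
  have "fact n * fps_nth ((fps_deriv ^^ Suc i) f) n
      = fact (Suc n) * fps_nth ((fps_deriv ^^ i) f) (Suc n)"
    by (simp add: algebra_simps)
  then show ?case using Suc[of "Suc n"] by (simp del: fact_Suc)
qed simp

definition stirling_sum :: "(nat \<Rightarrow> real) \<Rightarrow> (nat \<Rightarrow> nat) \<Rightarrow> real fps \<Rightarrow> nat set \<Rightarrow> real" where
  "stirling_sum b \<nu> f U = (\<Sum>m\<in>PiE U (\<lambda>j. {0..\<nu> j}).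
    (\<Prod>j\<in>U. real (Stirling (\<nu> j) (m j)) * b j ^ m j) * (fact (\<Sum>j\<in>U. m j) * fps_nth f (\<Sum>j\<in>U. m j)))"

lemma stirling_sum_empty [simp]: "stirling_sum b \<nu> f {} = fps_nth f 0"
  by (simp add: stirling_sum_def)

lemma stirling_sum_insert:
  assumes "finite U" "j \<notin> U"
  shows "stirling_sum b \<nu> f (insert j U)
    = (\<Sum>i\<le>\<nu> j. real (Stirling (\<nu> j) i) * b j ^ i * stirling_sum b \<nu> ((fps_deriv ^^ i) f) U)"
proof -
  let ?p = "\<lambda>m. \<Prod>l\<in>U. real (Stirling (\<nu> l) (m l)) * b l ^ m l"
  have upd: "(\<Sum>l\<in>U. (m(j := i)) l) = sum m U" "?p (m(j := i)) = ?p m" for m i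
    using assms(2) by (auto intro!: sum.cong prod.cong)
  have "stirling_sum b \<nu> f (insert j U) = (\<Sum>i\<in>{0..\<nu> j}. \<Sum>m\<in>PiE U (\<lambda>l. {0..\<nu> l}).
      real (Stirling (\<nu> j) i) * b j ^ i * ?p m * (fact (sum m U + i) * fps_nth f (sum m U + i)))"
    unfolding stirling_sum_def sum_PiE_insert[OF assms(2)] prod.insert[OF assms]
      sum.insert[OF assms] upd fun_upd_same by (simp only: add.commute)
  also have "\<dots> = (\<Sum>i\<le>\<nu> j. real (Stirling (\<nu> j) i) * b j ^ i
      * stirling_sum b \<nu> ((fps_deriv ^^ i) f) U)"
    unfolding stirling_sum_def fact_nth_fps_deriv_funpow atMost_atLeast0
    by (simp only: sum_distrib_left mult.assoc)
  finally show ?thesis .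
qed

lemma stirling_sum_cmult: "stirling_sum b \<nu> (fps_const c * f) U = c * stirling_sum b \<nu> f U"
  unfolding stirling_sum_def sum_distrib_left by (simp add: mult_ac)

lemma stirling_sum_cong:
  assumes "\<And>j. j \<in> U \<Longrightarrow> \<nu> j = \<mu> j"
  shows "stirling_sum b \<nu> f U = stirling_sum b \<mu> f U"
proof -
  have "PiE U (\<lambda>j. {0..\<nu> j}) = PiE U (\<lambda>j. {0..\<mu> j})"
    using assms by (intro PiE_cong) simp
  then show ?thesis unfolding stirling_sum_def using assms by simp
qed

lemma stirling_sum_mono_neutral:
  assumes "finite V" "U \<subseteq> V" "\<And>j. j \<in> V - U \<Longrightarrow> \<nu> j = 0"
  shows "stirling_sum b \<nu> f V = stirling_sum b \<nu> f U"
proof -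
  have "stirling_sum b \<nu> f (U \<union> D) = stirling_sum b \<nu> f U" if "finite D" "D \<subseteq> V - U" for D
    using that
  proof (induction rule: finite_induct)
    case (insert j D)
    then have "finite (U \<union> D)" "j \<notin> U \<union> D" "\<nu> j = 0"
      using assms finite_subset by auto
    with insert show ?case by (simp add: stirling_sum_insert)
  qed simp
  from this[of "V - U"] assms(1,2) show ?thesis by (simp add: Un_absorb1)
qed

lemma maj_deriv_replicate_append:
  assumes "k j = 0"
  shows "maj_deriv b 1 f k (replicate n j @ js)
      = (\<Sum>i\<le>n. real (Stirling n i) * b j ^ i * maj_deriv b 1 ((fps_deriv ^^ i) f) (k(j := i)) js)"
proof (induction n arbitrary: js)
  case 0
  show ?case using assms by (simp add: fun_upd_idem)
next
  case (Suc n)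
  let ?D = "\<lambda>i. maj_deriv b 1 ((fps_deriv ^^ i) f) (k(j := i)) js"
  have "maj_deriv b 1 f k (replicate (Suc n) j @ js) = maj_deriv b 1 f k (replicate n j @ (j # js))"
    by (simp add: replicate_append_same[symmetric])
  also have "\<dots> = (\<Sum>i\<le>n. real (Stirling n i) * b j ^ i * (b j * ?D (Suc i) + real i * ?D i))"
    by (subst Suc) simp
  also have "\<dots> = (\<Sum>i\<le>n. real (Stirling n i) * b j ^ Suc i * ?D (Suc i))
      + (\<Sum>i\<le>n. real i * real (Stirling n i) * b j ^ i * ?D i)"
    by (simp add: sum.distrib algebra_simps)
  also have "(\<Sum>i\<le>n. real i * real (Stirling n i) * b j ^ i * ?D i)
      = (\<Sum>i\<le>Suc n. real i * real (Stirling n i) * b j ^ i * ?D i)"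
    by simp
  also have "\<dots> = (\<Sum>i\<le>n. real (Suc i) * real (Stirling n (Suc i)) * b j ^ Suc i * ?D (Suc i))"
    by (subst sum.atMost_Suc_shift) simp
  also have "(\<Sum>i\<le>n. real (Stirling n i) * b j ^ Suc i * ?D (Suc i)) + \<dots>
      = (\<Sum>i\<le>n. real (Stirling (Suc n) (Suc i)) * b j ^ Suc i * ?D (Suc i))"
    by (simp add: sum.distrib[symmetric] algebra_simps)
  also have "\<dots> = (\<Sum>i\<le>Suc n. real (Stirling (Suc n) i) * b j ^ i * ?D i)"
    by (subst sum.atMost_Suc_shift) simp
  finally show ?case .
qed

lemma maj_deriv_concat_replicate:
  assumes "distinct us" "\<And>j. j \<in> set us \<Longrightarrow> k j = 0"
  shows "maj_deriv b 1 f k (concat (map (\<lambda>j. replicate (\<nu> j) j) us)) = stirling_sum b \<nu> f (set us)"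
  using assms
proof (induction us arbitrary: k f)
  case (Cons j us)
  have "maj_deriv b 1 g (k(j := i)) (concat (map (\<lambda>j. replicate (\<nu> j) j) us))
      = stirling_sum b \<nu> g (set us)" for g i
    using Cons.prems by (intro Cons.IH) auto
  then show ?case
    using Cons.prems by (simp add: maj_deriv_replicate_append stirling_sum_insert)
qed simp

definition geometric :: "real \<Rightarrow> real fps" where
  "geometric c = inverse (1 - fps_const c * fps_X)"

lemma geometric_power_nth:
  "n > 0 \<Longrightarrow> fps_nth (geometric c ^ n) k = real ((n + k - 1) choose k) * c ^ k"
  unfolding geometric_def fps_inverse_power[symmetric] one_minus_const_fps_X_neg_power' by simp

lemma geometric_nth: "fps_nth (geometric c) k = c ^ k"
  using geometric_power_nth[of 1 c k] by simp

lemma geometric_square_nth: "fps_nth (geometric c ^ 2) k = real (Suc k) * c ^ k"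
  using geometric_power_nth[of 2 c k] by simp

lemma geometric_cancel: "(1 - fps_const c * fps_X) * geometric c = 1"
  unfolding geometric_def by (rule inverse_mult_eq_1') simp

lemma geometric_eq: "geometric c = 1 + fps_const c * fps_X * geometric c"
  using geometric_cancel[of c] by (simp add: algebra_simps)

section \<open>Multi-indices and majorised functions\<close>

text \<open>\<^const>\<open>dmulti\<close> applies the last direction of \<^const>\<open>dlist\<close> first.\<close>

definition directions :: "nat \<Rightarrow> (nat \<Rightarrow> nat) \<Rightarrow> nat list" where
  "directions s \<nu> = rev (dlist s \<nu>)"

lemma (in product_domain) dmulti_eq_partials: "dmulti I s \<nu> F = partials (directions s \<nu>) F"
  by (simp add: dmulti_def diter_eq_partials directions_def)

lemma directions_eq_concat: "directions s \<nu> = concat (map (\<lambda>j. replicate (\<nu> j) j) (rev [0..<s]))"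
  by (simp add: directions_def dlist_def rev_concat rev_map comp_def)

lemma set_directions: "set (directions s \<nu>) \<subseteq> {..<s}"
  by (auto simp: directions_def dlist_def)

lemma length_directions: "length (directions s \<nu>) = mabs s \<nu>"
  by (simp add: directions_def dlist_def mabs_def length_concat comp_def
      interv_sum_list_conv_sum_set_nat lessThan_atLeast0)

lemma prod_list_directions:
  fixes f :: "nat \<Rightarrow> 'a :: comm_monoid_mult"
  shows "prod_list (map f (directions s \<nu>)) = (\<Prod>j<s. f j ^ \<nu> j)"
proof -
  have replicate: "prod_list (map f (replicate n j)) = f j ^ n" for n j
    by (induction n) auto
  have "prod_list (map f (concat (map (\<lambda>j. replicate (\<nu> j) j) js)))
      = prod_list (map (\<lambda>j. f j ^ \<nu> j) js)" for js
    by (induction js) (simp_all add: replicate)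
  then show ?thesis
    by (simp add: directions_def dlist_def rev_map[symmetric]
        prod.distinct_set_conv_list[symmetric] lessThan_atLeast0)
qed

lemma subseq_concat_replicate:
  assumes "distinct xs" "subseq l (concat (map (\<lambda>j. replicate (\<nu> j) j) xs))"
  shows "\<exists>\<mu>. l = concat (map (\<lambda>j. replicate (\<mu> j) j) xs)"
  using assms
proof (induction xs arbitrary: l)
  case (Cons j xs)
  then obtain l1 l2 where l: "l = l1 @ l2" "subseq l1 (replicate (\<nu> j) j)"
    "subseq l2 (concat (map (\<lambda>j. replicate (\<nu> j) j) xs))"
    by (auto elim: subseq_appendE)
  obtain \<mu> where \<mu>: "l2 = concat (map (\<lambda>j. replicate (\<mu> j) j) xs)"
    using Cons.IH[OF _ l(3)] Cons.prems(1) by auto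
  have "set l1 \<subseteq> {j}" using list_emb_set[OF l(2)] by auto
  then have l1: "replicate (length l1) j = l1"
    by (intro replicate_eqI[symmetric]) auto
  have "map (\<lambda>i. replicate ((\<mu>(j := length l1)) i) i) xs = map (\<lambda>i. replicate (\<mu> i) i) xs"
    using Cons.prems(1) by (intro map_cong) auto
  then have "concat (map (\<lambda>i. replicate ((\<mu>(j := length l1)) i) i) (j # xs)) = l"
    by (simp only: list.map concat.simps fun_upd_same l1 l(1) \<mu>)
  then show ?case by metis
qed simp

lemma subseq_directions: "subseq l (directions s \<nu>) \<Longrightarrow> \<exists>\<mu>. l = directions s \<mu>"
  unfolding directions_eq_concat by (rule subseq_concat_replicate) auto

lemma maj_deriv_zero:
  "maj_deriv b 0 f k js = prod_list (map b js) * (fact (length js) * fps_nth f (length js))"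
proof (induction js arbitrary: f k)
  case (Cons j js)
  then show ?case using fact_nth_fps_deriv_funpow[of "length js" 1 f] by simp
qed simp

lemma maj_deriv_zero_directions:
  "maj_deriv b 0 f k (directions s \<nu>) = bpow s b \<nu> * (fact (mabs s \<nu>) * fps_nth f (mabs s \<nu>))"
  by (simp add: maj_deriv_zero prod_list_directions length_directions bpow_def)

lemma maj_deriv_directions:
  "maj_deriv (\<lambda>j. c * b j) c f (\<lambda>_. 0) (directions s \<nu>) = c ^ mabs s \<nu> * stirling_sum b \<nu> f {..<s}"
proof -
  have "maj_deriv b 1 f (\<lambda>_. 0) (directions s \<nu>) = stirling_sum b \<nu> f {..<s}"
    unfolding directions_eq_concat
    by (subst maj_deriv_concat_replicate) (auto simp: lessThan_atLeast0)
  then show ?thesis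
    using maj_deriv_scale[of c b 1 f "\<lambda>_. 0" "directions s \<nu>"] by (simp add: length_directions)
qed

lemma mabs_alpha_u:
  assumes "u \<subseteq> {..<s}"
  shows "mabs s (alpha_u \<alpha> u) = \<alpha> * card u"
proof -
  have "mabs s (alpha_u \<alpha> u) = (\<Sum>j\<in>u. \<alpha>)"
    unfolding mabs_def alpha_u_def using assms by (intro sum.mono_neutral_cong_right) auto
  then show ?thesis by simp
qed

lemma prod_power_alpha_u:
  assumes "u \<subseteq> {..<s}"
  shows "(\<Prod>j<s. f j ^ alpha_u \<alpha> u j) = (\<Prod>j\<in>u. f j ^ \<alpha>)"
  using assms by (intro prod.mono_neutral_cong_right) (auto simp: alpha_u_def)

lemma stirling_sum_alpha_u:
  assumes "u \<subseteq> {..<s}"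
  shows "stirling_sum b (alpha_u \<alpha> u) f {..<s} = stirling_sum b (\<lambda>_. \<alpha>) f u"
proof -
  have "stirling_sum b (alpha_u \<alpha> u) f {..<s} = stirling_sum b (alpha_u \<alpha> u) f u"
    using assms by (intro stirling_sum_mono_neutral) (auto simp: alpha_u_def)
  also have "\<dots> = stirling_sum b (\<lambda>_. \<alpha>) f u"
    by (rule stirling_sum_cong) (simp add: alpha_u_def)
  finally show ?thesis .
qed

lemma per_bound_eq_stirling_sum: "per_bound s b \<nu> = stirling_sum b \<nu> (geometric 1) {..<s}"
  unfolding per_bound_def stirling_sum_def
  by (simp add: mabs_def bpow_def stirling_multi_def geometric_nth prod.distrib mult_ac)

definition majorised :: "real set \<Rightarrow> nat \<Rightarrow> (nat \<Rightarrow> real) \<Rightarrow> real \<Rightarrow> real fps \<Rightarrow>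
    ((nat \<Rightarrow> real) \<Rightarrow> real) \<Rightarrow> bool" where
  "majorised I s b w f F \<longleftrightarrow>
    (\<forall>\<nu>. \<forall>y\<in>cube s. \<bar>dmulti I s \<nu> F y\<bar> \<le> maj_deriv b w f (\<lambda>_. 0) (directions s \<nu>))"

lemma majorised_zero_iff:
  "majorised I s b 0 (fps_const C * geometric 1) F \<longleftrightarrow>
    (\<forall>\<nu>. \<forall>y\<in>cube s. \<bar>dmulti I s \<nu> F y\<bar> \<le> C * fact (mabs s \<nu>) * bpow s b \<nu>)"
  by (simp add: majorised_def maj_deriv_zero_directions geometric_nth mult_ac)

lemma majorised_per_bound_iff:
  "majorised I s (\<lambda>j. c * b j) c (fps_const C * geometric 1) F \<longleftrightarrow>
    (\<forall>\<nu>. \<forall>y\<in>cube s. \<bar>dmulti I s \<nu> F y\<bar> \<le> C * c ^ mabs s \<nu> * per_bound s b \<nu>)"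
  by (simp add: majorised_def maj_deriv_directions stirling_sum_cmult per_bound_eq_stirling_sum
      mult_ac)

locale cube_domain = product_domain +
  assumes unit_subset: "{0..1} \<subseteq> I"
begin

lemma cube_subset_dom: "cube s \<subseteq> dom"
  unfolding cube_def using unit_subset by (intro PiE_mono)

lemma majorised_partials:
  assumes "majorised I s b w f F" "y \<in> cube s" "subseq l (directions s \<nu>)"
  shows "\<bar>partials l F y\<bar> \<le> maj_deriv b w f (\<lambda>_. 0) l"
  using subseq_directions[OF assms(3)] assms(1,2)
  by (auto simp: majorised_def dmulti_eq_partials)

lemma majorised_diff:
  assumes "smooth F" "smooth G" "majorised I s b w f F" "majorised I s b w g G"
  shows "majorised I s b w (f + g) (\<lambda>y. F y - G y)"
  unfolding majorised_def
proof (intro allI ballI)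
  fix \<nu> y assume y: "y \<in> cube s"
  then have y': "y \<in> dom" using cube_subset_dom by blast
  let ?js = "directions s \<nu>"
  have "partials ?js (\<lambda>y. F y + (-1) * G y) y = partials ?js F y + (-1) * partials ?js G y"
    by (simp only: partials_add[OF assms(1) smooth_cmult[OF assms(2)] set_directions y']
        partials_cmult[OF assms(2) set_directions y'])
  then have "\<bar>partials ?js (\<lambda>y. F y - G y) y\<bar> \<le> \<bar>partials ?js F y\<bar> + \<bar>partials ?js G y\<bar>"
    by simp
  also have "\<dots> \<le> maj_deriv b w f (\<lambda>_. 0) ?js + maj_deriv b w g (\<lambda>_. 0) ?js"
    using assms(3,4) y by (intro add_mono) (auto simp: majorised_def dmulti_eq_partials)
  finally show "\<bar>dmulti I s \<nu> (\<lambda>y. F y - G y) y\<bar> \<le> maj_deriv b w (f + g) (\<lambda>_. 0) ?js"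
    by (simp add: dmulti_eq_partials maj_deriv_add)
qed

lemma majorised_mult:
  assumes "smooth F" "smooth G" "majorised I s b w f F" "majorised I s b w g G"
  shows "majorised I s b w (f * g) (\<lambda>y. F y * G y)"
  unfolding majorised_def
proof (intro allI ballI)
  fix \<nu> y assume y: "y \<in> cube s"
  have "\<bar>partials (directions s \<nu>) (\<lambda>y. F y * G y) y\<bar>
      \<le> leibniz_sum (maj_deriv b w f (\<lambda>_. 0)) (maj_deriv b w g (\<lambda>_. 0)) (directions s \<nu>)"
    using y cube_subset_dom assms
    by (intro abs_partials_mult_le set_directions majorised_partials) auto
  then show "\<bar>dmulti I s \<nu> (\<lambda>y. F y * G y) y\<bar> \<le> maj_deriv b w (f * g) (\<lambda>_. 0) (directions s \<nu>)"
    by (simp add: dmulti_eq_partials leibniz_sum_maj_deriv)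
qed

lemma majorised_square_diff:
  assumes "smooth F" "smooth G"
    and "majorised I s b w (fps_const C * g) F" "majorised I s b w (fps_const C * g) G"
  shows "majorised I s b w (fps_const (4 * C^2) * g^2) (\<lambda>y. (F y - G y)^2)"
proof -
  have "fps_const C * g + fps_const C * g = fps_const (2 * C) * g"
    by (simp only: distrib_right[symmetric] fps_const_add mult_2)
  then have "majorised I s b w (fps_const (2 * C) * g) (\<lambda>y. F y - G y)"
    using majorised_diff[OF assms] by (simp only:)
  then have "majorised I s b w (fps_const (2 * C) * g * (fps_const (2 * C) * g))
      (\<lambda>y. (F y - G y) * (F y - G y))"
    by (intro majorised_mult smooth_diff assms(1,2))
  moreover have "fps_const (2 * C) * g * (fps_const (2 * C) * g)
      = fps_const (2 * C) * fps_const (2 * C) * g^2"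
    by (simp only: power2_eq_square mult_ac)
  ultimately show ?thesis by (simp add: power2_eq_square)
qed

end

lemma cube_domain_unit: "cube_domain {0..1}"
  by (simp add: cube_domain_def cube_domain_axioms_def product_domain_atLeastAtMost)

lemma cube_domain_UNIV: "cube_domain UNIV"
  by (simp add: cube_domain_def cube_domain_axioms_def product_domain_UNIV)

section \<open>Derivatives of the network\<close>

lemma compact_cube: "compact (cube s)"
proof -
  have "cube s = PiE UNIV (\<lambda>j. if j < s then {0..1} else {undefined})"
    by (rule set_eqI) (simp add: cube_def PiE_iff extensional_def, meson lessThan_iff)
  moreover have "compactin (product_topology (\<lambda>_. euclidean) UNIV)
      (PiE UNIV (\<lambda>j. if j < s then {0..1 :: real} else {undefined}))"
    unfolding compactin_PiE by auto
  ultimately show ?thesis by (simp add: euclidean_product_topology)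
qed

lemma continuous_on_net:
  assumes "continuous_on UNIV \<sigma>" "continuous_on UNIV inp"
  shows "continuous_on UNIV (\<lambda>y. net \<sigma> W v d inp l y p)"
proof (induction l arbitrary: p)
  case 0
  have "continuous_on UNIV (\<lambda>y :: nat \<Rightarrow> real. inp (y j))" for j
    by (rule continuous_on_compose2[OF assms(2)]) auto
  then show ?case by (auto intro!: continuous_intros)
next
  case (Suc l)
  have "continuous_on UNIV (\<lambda>y. \<sigma> (net \<sigma> W v d inp l y q))" for q
    by (rule continuous_on_compose2[OF assms(1) Suc]) auto
  then show ?case by (auto intro!: continuous_intros)
qed

lemma abs_le_net_sup:
  assumes "\<And>p. p < n \<Longrightarrow> continuous_on UNIV (\<lambda>y. G y p)" "y \<in> cube s" "p < n"
  shows "\<bar>G y p\<bar> \<le> net_sup s n G"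
proof -
  let ?m = "\<lambda>y. Max ((\<lambda>p. \<bar>G y p\<bar>) ` {..<n})"
  have "\<exists>B. \<forall>y\<in>cube s. \<bar>G y p\<bar> \<le> B" if "p < n" for p
  proof -
    have "bounded ((\<lambda>y. G y p) ` cube s)"
      using assms(1)[OF that] compact_cube
      by (intro compact_imp_bounded compact_continuous_image) (auto intro: continuous_on_subset)
    then show ?thesis by (auto simp: bounded_iff)
  qed
  then obtain B where B: "\<And>p y. p < n \<Longrightarrow> y \<in> cube s \<Longrightarrow> \<bar>G y p\<bar> \<le> B p" by metis
  have "?m y \<le> Max (B ` {..<n})" if "y \<in> cube s" for y
    using B that assms(3) by (intro Max.boundedI) (auto intro: order_trans[OF _ Max_ge])
  then have "bdd_above (?m ` cube s)" by (auto intro!: bdd_aboveI)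
  then have "?m y \<le> net_sup s n G" unfolding net_sup_def by (intro cSUP_upper assms(2))
  moreover have "\<bar>G y p\<bar> \<le> ?m y" using assms(3) by (intro Max_ge) auto
  ultimately show ?thesis by simp
qed

lemma net_periodic:
  assumes "\<And>t. inp (t + 1) = inp t"
  shows "net \<sigma> W v d inp l (y(j := y j + 1)) = net \<sigma> W v d inp l y"
proof (induction l)
  case 0
  have "inp ((y(j := y j + 1)) i) = inp (y i)" for i using assms by simp
  then show ?case by (simp only: net.simps)
next
  case (Suc l)
  then show ?case by (simp only: net.simps)
qed

lemma smooth_fun_imp_continuous_on: "smooth_fun h \<Longrightarrow> continuous_on A h"
  using smooth_funD[of h 0] by (auto intro: DERIV_continuous_on has_field_derivative_at_within)

lemma inverse_one_minus_geometric:
  "inverse (1 - fps_const a * fps_X * geometric c) = 1 + fps_const a * fps_X * geometric (c + a)"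
proof (rule fps_inverse_unique)
  define u v where "u = 1 - fps_const c * fps_X" and "v = 1 - fps_const (c + a) * fps_X"
  have cancel: "u * geometric c = 1" "v * geometric (c + a) = 1"
    by (simp_all only: u_def v_def geometric_cancel)
  have v: "v = u - fps_const a * fps_X"
    by (simp only: u_def v_def fps_const_add[symmetric]) (simp add: algebra_simps)
  have "1 - fps_const a * fps_X * geometric c = v * geometric c"
    unfolding v left_diff_distrib cancel ..
  moreover have "1 + fps_const a * fps_X * geometric (c + a) = u * geometric (c + a)"
    using cancel(2) unfolding v by (simp add: algebra_simps)
  ultimately have "(1 - fps_const a * fps_X * geometric c)
      * (1 + fps_const a * fps_X * geometric (c + a))
      = (u * geometric c) * (v * geometric (c + a))" by (simp only: mult_ac)
  then show "(1 - fps_const a * fps_X * geometric c)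
      * (1 + fps_const a * fps_X * geometric (c + a)) = 1"
    by (simp only: cancel mult_1)
qed

lemma Pk_Suc: "Pk \<xi> \<tau> R (Suc l) = Pk \<xi> \<tau> R l * (\<xi> * \<tau> * R (Suc l))"
  by (simp add: Pk_def)

lemma SL_Suc: "SL \<xi> \<tau> R (Suc l) = SL \<xi> \<tau> R l + \<tau> * Pk \<xi> \<tau> R l"
  by (simp add: SL_def algebra_simps)

locale bounded_network =
  fixes s L Nobs :: nat and d :: "nat \<Rightarrow> nat"
    and W :: "nat \<Rightarrow> nat \<Rightarrow> nat \<Rightarrow> real" and v :: "nat \<Rightarrow> nat \<Rightarrow> real"
    and \<sigma> :: "real \<Rightarrow> real" and \<xi> \<tau> :: real and R b :: "nat \<Rightarrow> real"
  assumes L_pos: "L \<ge> 1" and d0: "d 0 = s" and dL: "d (Suc L) = Nobs"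
    and \<sigma>_smooth: "smooth_fun \<sigma>"
    and \<sigma>_bound: "n \<ge> 1 \<Longrightarrow> \<bar>(deriv ^^ n) \<sigma> x\<bar> \<le> \<xi> * \<tau> ^ n * fact n"
    and \<xi>_pos: "\<xi> > 0" and \<tau>_pos: "\<tau> > 0"
    and R_pos: "l \<in> {1..L} \<Longrightarrow> R l > 0"
    and W_norm: "l \<in> {1..L} \<Longrightarrow> mat_inf_norm W d l \<le> R l"
    and b_pos: "b j > 0"
    and \<beta>_bound: "j < s \<Longrightarrow> beta W d j \<le> b j / SL \<xi> \<tau> R L"
begin

abbreviation P :: "nat \<Rightarrow> real" where "P \<equiv> Pk \<xi> \<tau> R"

abbreviation S :: "nat \<Rightarrow> real" where "S \<equiv> SL \<xi> \<tau> R"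

lemma P_pos: "l \<le> L \<Longrightarrow> P l > 0"
  unfolding Pk_def using \<xi>_pos \<tau>_pos R_pos by (intro prod_pos) auto

lemma S_nonneg: "l \<le> L \<Longrightarrow> S l \<ge> 0"
  unfolding SL_def using \<tau>_pos P_pos
  by (intro mult_nonneg_nonneg sum_nonneg) (auto intro!: less_imp_le)

lemma S_pos: "S L > 0"
  unfolding SL_def using \<tau>_pos L_pos P_pos
  by (intro mult_pos_pos sum_pos) (auto simp: lessThan_empty_iff)

lemma S_le:
  assumes "\<rho> > 0" "\<forall>l\<in>{1..L-1}. R l \<le> \<rho>"
  shows "if \<xi> * \<tau> * \<rho> = 1 then S L \<le> \<tau> * real L
    else S L \<le> \<tau> * (((\<xi> * \<tau> * \<rho>) ^ L - 1) / (\<xi> * \<tau> * \<rho> - 1))"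
proof -
  define x where "x = \<xi> * \<tau> * \<rho>"
  have "P k \<le> x ^ k" if "k < L" for k
  proof -
    have "P k \<le> (\<Prod>t\<in>{1..k}. x)"
      unfolding Pk_def x_def using assms that \<xi>_pos \<tau>_pos R_pos
      by (intro prod_mono conjI mult_nonneg_nonneg mult_left_mono) (auto intro: less_imp_le)
    then show ?thesis by simp
  qed
  then have "S L \<le> \<tau> * (\<Sum>k<L. x ^ k)"
    unfolding SL_def using \<tau>_pos by (intro mult_left_mono sum_mono) auto
  also have "(\<Sum>k<L. x ^ k) = (if x = 1 then real L else (x ^ L - 1) / (x - 1))"
    using geometric_sum[of x L] by simp
  finally show ?thesis unfolding x_def by (simp split: if_splits)
qed

lemma abs_input_weight_le:
  assumes "p < d 1" "j < s"
  shows "\<bar>W 0 p j\<bar> \<le> b j / S L"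
proof -
  have "\<bar>W 0 p j\<bar> \<le> beta W d j" unfolding beta_def using assms(1) by (intro Max_ge) auto
  also have "\<dots> \<le> b j / S L" by (rule \<beta>_bound[OF assms(2)])
  finally show ?thesis .
qed

lemma sum_abs_row_le:
  assumes "l \<in> {1..L}" "p < d (Suc l)"
  shows "(\<Sum>q<d l. \<bar>W l p q\<bar>) \<le> R l"
proof -
  have "(\<Sum>q<d l. \<bar>W l p q\<bar>) \<le> mat_inf_norm W d l"
    unfolding mat_inf_norm_def using assms(2) by (intro Max_ge) auto
  also have "\<dots> \<le> R l" by (rule W_norm[OF assms(1)])
  finally show ?thesis .
qed

definition layer_majorant :: "nat \<Rightarrow> real fps" where
  "layer_majorant l = fps_const (P l / S L) * fps_X * geometric (S l / S L)"

lemma layer_majorant_nth: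
  "fps_nth (layer_majorant l) n = (if n = 0 then 0 else P l / S L * (S l / S L) ^ (n - 1))"
  by (simp add: layer_majorant_def mult.assoc geometric_nth)

lemma layer_majorant_nonneg: "l \<le> L \<Longrightarrow> fps_nth (layer_majorant l) n \<ge> 0"
  using P_pos[of l] S_nonneg[of l] S_pos by (simp add: layer_majorant_nth)

lemma layer_majorant_0: "layer_majorant 0 = fps_const (1 / S L) * fps_X"
  by (rule fps_ext) (simp add: layer_majorant_nth Pk_def SL_def power_0_left)

lemma layer_majorant_Suc:
  "fps_const (R (Suc l)) * geometric_deriv \<xi> \<tau> 0 (layer_majorant l)
    = layer_majorant (Suc l) + fps_const (\<xi> * R (Suc l))"
proof -
  define G where "G = fps_X * geometric (S (Suc l) / S L)"
  have "inverse (1 - fps_const \<tau> * layer_majorant l) = 1 + fps_const (\<tau> * P l / S L) * G"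
    using inverse_one_minus_geometric[of "\<tau> * P l / S L" "S l / S L"]
    by (simp add: layer_majorant_def G_def SL_Suc add_divide_distrib mult.assoc[symmetric])
  then have "fps_const (R (Suc l)) * geometric_deriv \<xi> \<tau> 0 (layer_majorant l)
      = fps_const (R (Suc l) * \<xi>) + fps_const (R (Suc l) * \<xi> * (\<tau> * P l / S L)) * G"
    by (simp add: geometric_deriv_def distrib_left mult.assoc[symmetric])
  also have "R (Suc l) * \<xi> * (\<tau> * P l / S L) = P (Suc l) / S L"
    by (simp add: Pk_Suc)
  finally show ?thesis
    by (simp add: layer_majorant_def G_def mult.assoc mult.commute[of \<xi>] add.commute)
qed

end

locale bounded_network_on = bounded_network s L Nobs d W v \<sigma> \<xi> \<tau> R b + cube_domain I s
  for s L Nobs d W v \<sigma> \<xi> \<tau> R b I +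
  fixes inp :: "real \<Rightarrow> real" and \<omega> w :: real
  assumes inp_smooth: "smooth_fun inp"
    and inp_bound: "\<bar>(deriv ^^ Suc n) inp x\<bar> \<le> \<omega> * w ^ n"
    and w_nonneg: "w \<ge> 0"
begin

abbreviation N :: "nat \<Rightarrow> nat \<Rightarrow> (nat \<Rightarrow> real) \<Rightarrow> real" where
  "N l p \<equiv> (\<lambda>y. net \<sigma> W v d inp l y p)"

abbreviation C\<^sub>L :: real where
  "C\<^sub>L \<equiv> max (net_sup s Nobs (net \<sigma> W v d inp L)) (P L / S L)"

abbreviation M :: "real fps \<Rightarrow> nat list \<Rightarrow> real" where
  "M f \<equiv> maj_deriv (\<lambda>j. \<omega> * b j) w f (\<lambda>_. 0)"

lemma \<omega>_nonneg: "\<omega> \<ge> 0"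
  using inp_bound[of 0 0] by simp

lemma M_nonneg: "(\<And>n. fps_nth f n \<ge> 0) \<Longrightarrow> M f js \<ge> 0"
  using b_pos[THEN less_imp_le] \<omega>_nonneg w_nonneg by (intro maj_deriv_nonneg) auto

lemma smooth_input: "smooth (\<lambda>y. inp (y i))"
  using smooth_compose[OF inp_smooth smooth_coordinate, of 0] by simp

lemma smooth_net: "smooth (N l p)"
  and smooth_activation: "smooth (\<lambda>y. \<sigma> (N l p y))"
proof -
  have activation: "smooth (\<lambda>y. \<sigma> (F y))" if "smooth F" for F
    using smooth_compose[OF \<sigma>_smooth that, of 0] by simp
  show "smooth (N l p)"
  proof (induction l arbitrary: p)
    case 0
    show ?case unfolding net.simps
      by (intro smooth_add smooth_const smooth_sum smooth_cmult smooth_input) auto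
  next
    case (Suc l)
    show ?case unfolding net.simps
      by (intro smooth_add smooth_const smooth_sum smooth_cmult activation Suc) auto
  qed
  then show "smooth (\<lambda>y. \<sigma> (N l p y))" by (rule activation)
qed

lemma abs_partials_input_layer_le:
  assumes "p < d 1" "js \<noteq> []" "set js \<subseteq> {..<s}" "y \<in> dom"
  shows "\<bar>partials js (N 0 p) y\<bar> \<le> M (layer_majorant 0) js"
proof (cases js)
  case (Cons j ls)
  define D where "D = (if set ls \<subseteq> {j} then (deriv ^^ Suc (length ls)) inp (y j) else 0)"
  have j: "j < s" using assms(3) Cons by simp
  have "partials js (N 0 p) y = (\<Sum>i<s. W 0 p i * partials js (\<lambda>y. inp (y i)) y)"
    unfolding net.simps d0 using assms(2-4) by (intro partials_affine smooth_input) auto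
  also have "\<dots> = (\<Sum>i<s. if i = j then W 0 p j * D else 0)"
    unfolding partials_coordinate[OF inp_smooth assms(3,4)]
    by (intro sum.cong) (auto simp: Cons D_def)
  also have "\<dots> = W 0 p j * D" using j by simp
  finally have "\<bar>partials js (N 0 p) y\<bar> = \<bar>W 0 p j\<bar> * \<bar>D\<bar>" by (simp add: abs_mult)
  also have "\<dots> \<le> b j / S L * (if set ls \<subseteq> {j} then \<omega> * w ^ length ls else 0)"
    using abs_input_weight_le[OF assms(1) j] inp_bound b_pos[of j] S_pos
    by (intro mult_mono) (auto simp: D_def simp del: funpow.simps)
  also have "\<dots> = M (layer_majorant 0) js"
    by (simp add: layer_majorant_0 Cons maj_deriv_X del: maj_deriv.simps)
  finally show ?thesis .
qed (use assms(2) in simp)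

lemma abs_partials_layer_le:
  assumes "l \<le> L" "p < d (Suc l)" "js \<noteq> []" "set js \<subseteq> {..<s}" "y \<in> dom"
  shows "\<bar>partials js (N l p) y\<bar> \<le> M (layer_majorant l) js"
  using assms(1-4)
proof (induction l arbitrary: p js)
  case 0
  then show ?case using assms(5) by (intro abs_partials_input_layer_le) auto
next
  case (Suc l)
  define K where "K = M (geometric_deriv \<xi> \<tau> 0 (layer_majorant l)) js"
  have activation: "\<bar>partials js (\<lambda>y. \<sigma> (N l q y)) y\<bar> \<le> K" if "q < d (Suc l)" for q
    using abs_partials_compose_le[OF \<sigma>_smooth \<sigma>_bound smooth_net assms(5),
        of l q "\<lambda>j. \<omega> * b j" w "layer_majorant l" js 0]
      Suc that by (simp add: K_def layer_majorant_nth)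
  have "R (Suc l) * K = M (layer_majorant (Suc l) + fps_const (\<xi> * R (Suc l))) js"
    unfolding K_def maj_deriv_cmult[symmetric] layer_majorant_Suc ..
  also have "\<dots> = M (layer_majorant (Suc l)) js"
    by (rule maj_deriv_add_const[OF Suc.prems(3)])
  finally have R_mult_K: "R (Suc l) * K = M (layer_majorant (Suc l)) js" .
  then have "R (Suc l) * K \<ge> 0"
    using M_nonneg layer_majorant_nonneg Suc.prems(1) by simp
  then have K_nonneg: "K \<ge> 0"
    using R_pos[of "Suc l"] Suc.prems(1) by (simp add: zero_le_mult_iff)
  have "partials js (N (Suc l) p) y
      = (\<Sum>q<d (Suc l). W (Suc l) p q * partials js (\<lambda>y. \<sigma> (N l q y)) y)"
    unfolding net.simps using Suc.prems assms(5) by (intro partials_affine smooth_activation) auto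
  also have "\<bar>\<dots>\<bar> \<le> (\<Sum>q<d (Suc l). \<bar>W (Suc l) p q\<bar> * K)"
    using activation
    by (intro order_trans[OF sum_abs sum_mono]) (auto simp: abs_mult intro: mult_left_mono)
  also have "\<dots> \<le> R (Suc l) * K"
    unfolding sum_distrib_right[symmetric]
    using sum_abs_row_le[of "Suc l" p] Suc.prems K_nonneg by (intro mult_right_mono) auto
  finally show ?case unfolding R_mult_K .
qed

lemma majorised_net:
  assumes "C\<^sub>L \<le> C" "p < Nobs"
  shows "majorised I s (\<lambda>j. \<omega> * b j) w (fps_const C * geometric 1) (N L p)"
  unfolding majorised_def
proof (intro allI ballI)
  fix \<nu> y assume y: "y \<in> cube s"
  let ?js = "directions s \<nu>"
  have "\<bar>partials ?js (N L p) y\<bar> \<le> M (fps_const C * geometric 1) ?js"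
  proof (cases "?js = []")
    case True
    have "\<bar>N L p y\<bar> \<le> net_sup s Nobs (net \<sigma> W v d inp L)"
      by (intro abs_le_net_sup continuous_on_net smooth_fun_imp_continuous_on \<sigma>_smooth inp_smooth
          y assms(2))
    with True assms(1) show ?thesis by (simp add: geometric_nth)
  next
    case False
    have "layer_majorant L = fps_const (P L / S L) * (fps_X * geometric 1)"
      using S_pos by (simp add: layer_majorant_def mult.assoc)
    moreover have "M (geometric 1) ?js = M (fps_X * geometric 1) ?js"
      using geometric_eq[of 1]
        maj_deriv_add_const[OF False, of "\<lambda>j. \<omega> * b j" w "fps_X * geometric 1" 1]
      by (simp add: add.commute)
    ultimately have "\<bar>partials ?js (N L p) y\<bar> \<le> P L / S L * M (geometric 1) ?js"
      using abs_partials_layer_le[OF order_refl _ False set_directions, of p y] y cube_subset_dom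
          assms(2) dL
      by (auto simp: maj_deriv_cmult)
    also have "\<dots> \<le> C * M (geometric 1) ?js"
      using assms(1) by (intro mult_right_mono M_nonneg) (auto simp: geometric_nth)
    finally show ?thesis by (simp add: maj_deriv_cmult)
  qed
  then show "\<bar>dmulti I s \<nu> (N L p) y\<bar> \<le> M (fps_const C * geometric 1) ?js"
    by (simp add: dmulti_eq_partials)
qed

end

section \<open>Restriction to a smaller domain\<close>

lemma has_partial_deriv_subset:
  assumes "product_domain I" "product_domain J" "J \<subseteq> I"
    "product_domain.has_partial_deriv I s j F F'"
  shows "product_domain.has_partial_deriv J s j F F'"
  unfolding product_domain.has_partial_deriv_def[OF assms(2)]
proof
  fix y assume "y \<in> PiE {..<s} (\<lambda>_. J)"
  then have "y \<in> PiE {..<s} (\<lambda>_. I)" using PiE_mono[of "{..<s}" "\<lambda>_. J" "\<lambda>_. I"] assms(3) by blast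
  then show "((\<lambda>t. F (y(j := t))) has_real_derivative F' y) (at (y j) within J)"
    using assms(4) unfolding product_domain.has_partial_deriv_def[OF assms(1)]
    by (intro DERIV_subset[OF _ assms(3)]) blast
qed

lemma smooth_on_subset:
  assumes "product_domain I" "product_domain J" "J \<subseteq> I" "smooth_on I s F"
  shows "smooth_on J s F"
proof -
  interpret I: product_domain I s by (rule assms(1))
  interpret J: product_domain J s by (rule assms(2))
  have "J.differentiable_upto n F" if "I.differentiable_upto n F" for n
    using that
    by (induction n arbitrary: F) (auto, blast intro: has_partial_deriv_subset[OF assms(1-3)])
  with assms(4) show ?thesis
    by (simp add: I.smooth_iff_differentiable_upto J.smooth_iff_differentiable_upto)
qed

lemma dmulti_subset:
  assumes "product_domain I" "product_domain J" "J \<subseteq> I" "smooth_on I s F" "y \<in> PiE {..<s} (\<lambda>_. J)"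
  shows "dmulti J s \<nu> F y = dmulti I s \<nu> F y"
proof -
  interpret I: product_domain I s by (rule assms(1))
  interpret J: product_domain J s by (rule assms(2))
  have "J.partials js F y = I.partials js F y" if "set js \<subseteq> {..<s}" for js
    using that assms(4)
  proof (induction js arbitrary: F)
    case (Cons j js)
    then have j: "j < s" and smooth': "I.smooth (dpartial I j F)"
      by (simp_all add: I.smooth_dpartial)
    have "J.has_partial_deriv j F (dpartial I j F)"
      using has_partial_deriv_subset[OF assms(1-3)
          I.smooth_imp_has_partial_deriv[OF Cons.prems(2) j]] .
    then have "J.partials (j # js) F y = J.partials js (dpartial I j F) y"
      by (rule J.partials_Cons_eq[OF _ smooth_on_subset[OF assms(1-3) smooth'] Cons.prems(1)
          assms(5)])
    also have "\<dots> = I.partials js (dpartial I j F) y"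
      using Cons.prems(1) by (intro Cons.IH smooth') simp
    finally show ?case by simp
  qed simp
  then show ?thesis
    by (simp add: I.dmulti_eq_partials J.dmulti_eq_partials set_directions)
qed

lemma majorised_unit_subset:
  assumes "smooth_on UNIV s F" "majorised UNIV s b w f F"
  shows "majorised {0..1} s b w f F"
  using assms(2)
    dmulti_subset[OF product_domain_UNIV product_domain_atLeastAtMost[OF zero_less_one] _ assms(1)]
  by (simp add: majorised_def cube_def)

section \<open>The Sobolev norm\<close>

lemma space_unitI [simp]: "space unitI = {0..1}"
  by (simp add: unitI_def space_restrict_space)

lemma prob_space_unitI: "prob_space unitI"
  by (rule prob_spaceI) (simp add: unitI_def space_restrict_space emeasure_restrict_space)

lemma prob_space_PiM_unitI: "prob_space (PiM A (\<lambda>_. unitI))"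
  by (rule prob_space_PiM) (rule prob_space_unitI)

lemma space_PiM_unitI: "space (PiM A (\<lambda>_. unitI)) = PiE A (\<lambda>_. {0..1})"
  by (simp add: space_PiM)

text \<open>No measurability is needed: the integral of a function that is not integrable is \<open>0\<close>.\<close>

lemma (in prob_space) norm_integral_le_bound:
  fixes f :: "'a \<Rightarrow> 'b::{banach, second_countable_topology}"
  assumes "\<And>x. x \<in> space M \<Longrightarrow> norm (f x) \<le> B"
  shows "norm (integral\<^sup>L M f) \<le> B"
proof (cases "integrable M f")
  case True
  have "norm (integral\<^sup>L M f) \<le> (\<integral>x. norm (f x) \<partial>M)" by simp
  also have "\<dots> \<le> (\<integral>x. B \<partial>M)"
    using True assms by (intro integral_mono) auto
  also have "\<dots> = B" by (simp add: prob_space)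
  finally show ?thesis .
next
  case False
  obtain x where "x \<in> space M" using not_empty by blast
  then have "0 \<le> B" using assms norm_ge_zero order_trans by blast
  then show ?thesis using False by (simp add: not_integrable_integral_eq)
qed

lemma merge_in_cube:
  assumes "u \<subseteq> {..<s}" "yu \<in> PiE u (\<lambda>_. {0..1})" "yv \<in> PiE ({..<s} - u) (\<lambda>_. {0..1})"
  shows "merge u ({..<s} - u) (yu, yv) \<in> cube s"
  using assms by (auto simp: cube_def merge_def PiE_iff extensional_def)

lemma integral_square_partial_integral_le:
  fixes D :: "(nat \<Rightarrow> real) \<Rightarrow> real"
  assumes "u \<subseteq> {..<s}" "\<And>y. y \<in> cube s \<Longrightarrow> \<bar>D y\<bar> \<le> B"
  shows "(\<integral>yu. (\<integral>yv. D (merge u ({..<s} - u) (yu, yv)) \<partial>(PiM ({..<s} - u) (\<lambda>_. unitI))) ^ 2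
    \<partial>(PiM u (\<lambda>_. unitI))) \<le> B^2"
proof -
  let ?v = "{..<s} - u"
  interpret u: prob_space "PiM u (\<lambda>_. unitI)" by (rule prob_space_PiM_unitI)
  interpret v: prob_space "PiM ?v (\<lambda>_. unitI)" by (rule prob_space_PiM_unitI)
  define D\<^sub>u where "D\<^sub>u yu = (\<integral>yv. D (merge u ?v (yu, yv)) \<partial>(PiM ?v (\<lambda>_. unitI)))" for yu
  have "norm (D\<^sub>u yu) \<le> B" if "yu \<in> PiE u (\<lambda>_. {0..1})" for yu
    unfolding D\<^sub>u_def
    using assms merge_in_cube[OF assms(1) that]
    by (intro v.norm_integral_le_bound) (simp add: space_PiM_unitI)
  then have "norm ((D\<^sub>u yu)^2) \<le> B^2" if "yu \<in> PiE u (\<lambda>_. {0..1})" for yu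
    using that power_mono[of "\<bar>D\<^sub>u yu\<bar>" B 2] by simp
  then have "norm (\<integral>yu. (D\<^sub>u yu)^2 \<partial>(PiM u (\<lambda>_. unitI))) \<le> B^2"
    by (intro u.norm_integral_le_bound) (simp add: space_PiM_unitI)
  then show ?thesis by (simp add: D\<^sub>u_def)
qed

lemma sob_sq_le:
  assumes "\<And>u. u \<subseteq> {..<s} \<Longrightarrow> \<gamma> u > 0" "majorised {0..1} s b w f F"
  shows "sob_sq s \<alpha> \<gamma> F
    \<le> (\<Sum>u\<in>Pow {..<s}. (1 / \<gamma> u) * (maj_deriv b w f (\<lambda>_. 0) (directions s (alpha_u \<alpha> u)))^2)"
  unfolding sob_sq_def
proof (intro sum_mono mult_left_mono integral_square_partial_integral_le)
  show "0 \<le> 1 / \<gamma> u" if "u \<in> Pow {..<s}" for u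
    using assms(1)[of u] that by simp
qed (use assms(2) in \<open>auto simp: majorised_def\<close>)

lemma sob_sq_le_zero_frequency:
  assumes "\<And>u. u \<subseteq> {..<s} \<Longrightarrow> \<gamma> u > 0" "majorised {0..1} s b 0 (fps_const K * f) F"
  shows "sob_sq s 1 \<gamma> F
    \<le> K^2 * (\<Sum>u\<in>Pow {..<s}. (1 / \<gamma> u) * (fact (card u) * fps_nth f (card u) * (\<Prod>j\<in>u. b j))^2)"
proof -
  have "maj_deriv b 0 (fps_const K * f) (\<lambda>_. 0) (directions s (alpha_u 1 u))
      = K * (fact (card u) * fps_nth f (card u) * (\<Prod>j\<in>u. b j))" if "u \<in> Pow {..<s}" for u
    using that by (simp add: maj_deriv_zero_directions mabs_alpha_u bpow_def prod_power_alpha_u)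
  then show ?thesis
    using sob_sq_le[OF assms, where \<alpha> = 1]
    by (simp add: sum_distrib_left power_mult_distrib mult_ac)
qed

lemma sob_sq_le_stirling_sum:
  assumes "\<And>u. u \<subseteq> {..<s} \<Longrightarrow> \<gamma> u > 0" "smooth_on UNIV s F"
    and "majorised UNIV s (\<lambda>j. c * b j) c (fps_const K * f) F"
  shows "sob_sq s \<alpha> \<gamma> F
    \<le> K^2 * (\<Sum>u\<in>Pow {..<s}. c ^ (2 * \<alpha> * card u) / \<gamma> u * (stirling_sum b (\<lambda>_. \<alpha>) f u)^2)"
proof -
  have "(maj_deriv (\<lambda>j. c * b j) c (fps_const K * f) (\<lambda>_. 0) (directions s (alpha_u \<alpha> u)))^2
      = K^2 * (c ^ (2 * \<alpha> * card u) * (stirling_sum b (\<lambda>_. \<alpha>) f u)^2)" if "u \<in> Pow {..<s}" for u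
    using that unfolding maj_deriv_cmult
    by (simp add: maj_deriv_directions mabs_alpha_u stirling_sum_alpha_u
        power_mult_distrib power_mult[symmetric] mult_ac)
  then show ?thesis
    using sob_sq_le[OF assms(1) majorised_unit_subset[OF assms(2,3)], where \<alpha> = \<alpha>]
    by (simp add: sum_distrib_left mult_ac)
qed

section \<open>The Korobov norm\<close>

lemma LIMSEQ_floor_mult_divide: "(\<lambda>n. real_of_int \<lfloor>t * real (Suc n)\<rfloor> / real (Suc n)) \<longlonglongrightarrow> t"
proof (rule tendsto_sandwich)
  have "real_of_int \<lfloor>t * real (Suc n)\<rfloor> / real (Suc n) \<le> t" for n
    by (simp add: divide_le_eq del: of_nat_Suc)
  then show "\<forall>\<^sub>F n in sequentially. real_of_int \<lfloor>t * real (Suc n)\<rfloor> / real (Suc n) \<le> t" by simp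
  have "t - inverse (real (Suc n)) \<le> real_of_int \<lfloor>t * real (Suc n)\<rfloor> / real (Suc n)" for n
  proof -
    have "t - inverse (real (Suc n)) = (t * real (Suc n) - 1) / real (Suc n)"
      by (simp add: field_simps)
    also have "\<dots> \<le> real_of_int \<lfloor>t * real (Suc n)\<rfloor> / real (Suc n)"
      by (intro divide_right_mono) linarith+
    finally show ?thesis .
  qed
  then show "\<forall>\<^sub>F n in sequentially. t - inverse (real (Suc n))
      \<le> real_of_int \<lfloor>t * real (Suc n)\<rfloor> / real (Suc n)"
    by simp
  show "(\<lambda>n. t - inverse (real (Suc n))) \<longlonglongrightarrow> t"
    using tendsto_diff[OF tendsto_const LIMSEQ_inverse_real_of_nat, of t] by simp
qed simp

text \<open>Rounding one coordinate to a grid leaves countably many functions of the other coordinates.\<close>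

lemma borel_measurable_override_on_separately_continuous:
  fixes F :: "('i \<Rightarrow> real) \<Rightarrow> real"
  assumes "\<And>y j. y \<in> extensional A \<Longrightarrow> j \<in> A \<Longrightarrow> continuous_on UNIV (\<lambda>t. F (y(j := t)))"
    and "finite J" "J \<subseteq> A" "z \<in> extensional A"
  shows "(\<lambda>y. F (override_on z y J)) \<in> borel_measurable (PiM A (\<lambda>_. borel))"
  using assms(2-4)
proof (induction J arbitrary: z rule: finite_induct)
  case (insert j J)
  have j: "j \<in> A" "j \<notin> J" using insert by auto
  define round where "round n t = real_of_int \<lfloor>t * real (Suc n)\<rfloor> / real (Suc n)"
    for n and t :: real
  have override: "(override_on z y J)(j := t) = override_on (z(j := t)) y J" for y t
    using j(2) by (auto simp: override_on_def)
  have rounded: "(\<lambda>y. F ((override_on z y J)(j := round n (y j))))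
      \<in> borel_measurable (PiM A (\<lambda>_. borel))" for n
    unfolding round_def override
  proof (rule measurable_compose_countable[where g = "\<lambda>y. \<lfloor>y j * real (Suc n)\<rfloor>"])
    show "(\<lambda>y. F (override_on (z(j := real_of_int i / real (Suc n))) y J))
        \<in> borel_measurable (PiM A (\<lambda>_. borel))" for i
      using insert.prems j by (intro insert.IH) (auto simp: extensional_def)
    show "(\<lambda>y. \<lfloor>y j * real (Suc n)\<rfloor>) \<in> measurable (PiM A (\<lambda>_. borel)) (count_space UNIV)"
      using j(1) by measurable
  qed
  show ?case
  proof (rule borel_measurable_LIMSEQ_real[OF _ rounded])
    fix y
    have "override_on z y J \<in> extensional A"
      using insert.prems by (auto simp: override_on_def extensional_def)
    then have "isCont (\<lambda>t. F ((override_on z y J)(j := t))) (y j)"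
      using assms(1) j(1) by (simp add: continuous_on_eq_continuous_at)
    from isCont_tendsto_compose[OF this LIMSEQ_floor_mult_divide]
    show "(\<lambda>n. F ((override_on z y J)(j := round n (y j)))) \<longlonglongrightarrow> F (override_on z y (insert j J))"
      by (simp add: round_def override_on_insert)
  qed
qed simp

lemma borel_measurable_separately_continuous:
  fixes F :: "('i \<Rightarrow> real) \<Rightarrow> real"
  assumes "finite A" "\<And>y j. y \<in> extensional A \<Longrightarrow> j \<in> A \<Longrightarrow> continuous_on UNIV (\<lambda>t. F (y(j := t)))"
  shows "F \<in> borel_measurable (PiM A (\<lambda>_. borel))"
proof -
  have "(\<lambda>y. F (override_on (\<lambda>_. undefined) y A)) \<in> borel_measurable (PiM A (\<lambda>_. borel))"
    by (intro borel_measurable_override_on_separately_continuous assms order_refl)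
      (simp_all add: extensional_def)
  moreover have "override_on (\<lambda>_. undefined) y A = y"
    if "y \<in> space (PiM A (\<lambda>_. borel))" for y :: "'i \<Rightarrow> real"
    using that by (auto simp: override_on_def space_PiM PiE_iff extensional_def)
  ultimately show ?thesis by (simp cong: measurable_cong)
qed

lemma measurable_unitI_component: "j \<in> A \<Longrightarrow> (\<lambda>y. y j) \<in> borel_measurable (PiM A (\<lambda>_. unitI))"
  using measurable_component_singleton[of j A "\<lambda>_. unitI"]
  by (simp add: unitI_def measurable_restrict_space2_iff)

lemma borel_measurable_PiM_unitI:
  assumes "F \<in> borel_measurable (PiM A (\<lambda>_. borel))"
  shows "F \<in> borel_measurable (PiM A (\<lambda>_. unitI))"
proof -
  have "(\<lambda>y. restrict y A) \<in> measurable (PiM A (\<lambda>_. unitI)) (PiM A (\<lambda>_. borel))"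
    by (intro measurable_restrict measurable_unitI_component)
  then have "(\<lambda>y. F (restrict y A)) \<in> borel_measurable (PiM A (\<lambda>_. unitI))"
    using assms by (rule measurable_compose)
  moreover have "restrict y A = y" if "y \<in> space (PiM A (\<lambda>_. unitI))" for y
    using that by (simp add: space_PiM PiE_restrict)
  ultimately show ?thesis by (simp cong: measurable_cong)
qed

lemma integral_unitI_deriv_eq_zero:
  fixes H :: "real \<Rightarrow> 'a :: euclidean_space"
  assumes "\<And>t. (H has_vector_derivative H' t) (at t)" "continuous_on {0..1} H'" "H 1 = H 0"
  shows "(\<integral>t. H' t \<partial>unitI) = 0"
proof -
  have "(\<integral>t. H' t \<partial>unitI) = (\<integral>t. indicator {0..1} t *\<^sub>R H' t \<partial>lborel)"
    unfolding unitI_def by (rule integral_restrict_space) simp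
  also have "\<dots> = H 1 - H 0"
    using assms(1,2)
    by (intro integral_FTC_atLeastAtMost) (auto intro: has_vector_derivative_at_within)
  finally show ?thesis using assms(3) by simp
qed

lemma integral_cube_eq_zero:
  fixes g :: "(nat \<Rightarrow> real) \<Rightarrow> 'a :: {banach, second_countable_topology}"
  assumes "integrable (PiM {..<s} (\<lambda>_. unitI)) g" "j < s"
    and "\<And>y. y \<in> cube s \<Longrightarrow> (\<integral>t. g (y(j := t)) \<partial>unitI) = 0"
  shows "(\<integral>y. g y \<partial>PiM {..<s} (\<lambda>_. unitI)) = 0"
proof -
  interpret product_sigma_finite "\<lambda>_ :: nat. unitI"
    by (rule product_sigma_finite.intro) (rule prob_space_imp_sigma_finite[OF prob_space_unitI])
  let ?J = "{..<s} - {j}"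
  have insert: "insert j ?J = {..<s}" using assms(2) by auto
  have "(\<integral>t. g (x(j := t)) \<partial>unitI) = 0" if "x \<in> PiE ?J (\<lambda>_. {0..1})" for x
  proof -
    have "x(j := 0) \<in> cube s" using that assms(2) by (auto simp: cube_def PiE_iff extensional_def)
    from assms(3)[OF this] show ?thesis by simp
  qed
  then have "(\<integral>x. (\<integral>t. g (x(j := t)) \<partial>unitI) \<partial>PiM ?J (\<lambda>_. unitI)) = (\<integral>x. 0 \<partial>PiM ?J (\<lambda>_. unitI))"
    by (intro Bochner_Integration.integral_cong refl) (simp add: space_PiM_unitI)
  then show ?thesis
    using product_integral_insert[of ?J j g, unfolded insert] assms(1) by simp
qed

definition character :: "nat \<Rightarrow> (nat \<Rightarrow> int) \<Rightarrow> (nat \<Rightarrow> real) \<Rightarrow> complex" where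
  "character s h y = cis (- 2 * pi * (\<Sum>j<s. real_of_int (h j) * y j))"

lemma fourier_coeff_eq_integral_character:
  "fourier_coeff s F h = (\<integral>y. complex_of_real (F y) * character s h y \<partial>PiM {..<s} (\<lambda>_. unitI))"
  by (simp add: fourier_coeff_def character_def)

lemma norm_character [simp]: "norm (character s h y) = 1"
  by (simp add: character_def)

lemma borel_measurable_character: "character s h \<in> borel_measurable (PiM {..<s} (\<lambda>_. unitI))"
proof -
  have "(\<lambda>y. - 2 * pi * (\<Sum>j<s. real_of_int (h j) * y j))
      \<in> borel_measurable (PiM {..<s} (\<lambda>_. unitI))"
    by (intro borel_measurable_times borel_measurable_const borel_measurable_sum
        measurable_unitI_component)
  then show ?thesis
    unfolding character_def[abs_def]
    by (rule measurable_compose) (intro borel_measurable_continuous_onI continuous_intros)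
qed

lemma character_fun_upd:
  assumes "j < s"
  shows "character s h (y(j := t))
    = cis (- 2 * pi * (real_of_int (h j) * t + (\<Sum>i\<in>{..<s} - {j}. real_of_int (h i) * y i)))"
proof -
  have "(\<Sum>i<s. real_of_int (h i) * (y(j := t)) i)
      = real_of_int (h j) * t + (\<Sum>i\<in>{..<s} - {j}. real_of_int (h i) * y i)"
    using assms by (subst sum.remove[of _ j]) auto
  then show ?thesis by (simp only: character_def)
qed

lemma character_has_vector_derivative:
  assumes "j < s"
  shows "((\<lambda>t. character s h (y(j := t))) has_vector_derivative
    (- 2 * pi * real_of_int (h j)) *\<^sub>R (\<i> * character s h (y(j := t)))) (at t)"
proof -
  let ?c = "\<Sum>i\<in>{..<s} - {j}. real_of_int (h i) * y i"
  have "((\<lambda>t. - 2 * pi * (real_of_int (h j) * t + ?c))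
      has_real_derivative - 2 * pi * real_of_int (h j)) (at t)"
    by (auto intro!: derivative_eq_intros)
  from has_derivative_cis[OF this[unfolded has_field_derivative_def]] show ?thesis
    unfolding character_fun_upd[OF assms] has_vector_derivative_def
    by (rule has_derivative_eq_rhs) (simp add: fun_eq_iff scaleR_conv_of_real mult_ac)
qed

lemma character_periodic:
  assumes "j < s"
  shows "character s h (y(j := t + 1)) = character s h (y(j := t))"
proof -
  have "character s h (y(j := t + 1)) = character s h (y(j := t))
      * cis (2 * pi * real_of_int (- h j))"
    unfolding character_fun_upd[OF assms] cis_mult by (simp add: algebra_simps)
  moreover have "cis (2 * pi * real_of_int (- h j)) = 1" by (rule cis_multiple_2pi) simp
  ultimately show ?thesis by simp
qed

definition one_periodic :: "nat \<Rightarrow> ((nat \<Rightarrow> real) \<Rightarrow> real) \<Rightarrow> bool" where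
  "one_periodic s F \<longleftrightarrow> (\<forall>y\<in>real_space s. \<forall>j<s. F (y(j := y j + 1)) = F y)"

locale real_domain = cube_domain UNIV s for s
begin

abbreviation cube_measure :: "(nat \<Rightarrow> real) measure" where
  "cube_measure \<equiv> PiM {..<s} (\<lambda>_. unitI)"

lemma space_cube_measure: "space cube_measure = cube s"
  by (simp add: space_PiM_unitI cube_def)

lemma one_periodicD: "one_periodic s F \<Longrightarrow> y \<in> dom \<Longrightarrow> j < s \<Longrightarrow> F (y(j := t + 1)) = F (y(j := t))"
  using dom_upd[of y j t] unfolding one_periodic_def real_space_def by force

lemma smooth_has_real_derivative:
  assumes "smooth F" "y \<in> dom" "j < s"
  shows "((\<lambda>t. F (y(j := t))) has_real_derivative dpartial UNIV j F (y(j := t))) (at t)"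
  using has_partial_derivD[OF smooth_imp_has_partial_deriv[OF assms(1,3)] assms(2,3) UNIV_I] .

lemma smooth_continuous_on:
  assumes "smooth F" "y \<in> dom" "j < s"
  shows "continuous_on A (\<lambda>t. F (y(j := t)))"
  using DERIV_isCont[OF smooth_has_real_derivative[OF assms]]
  by (simp add: continuous_at_imp_continuous_on)

lemma smooth_borel_measurable: "smooth F \<Longrightarrow> F \<in> borel_measurable cube_measure"
  by (intro borel_measurable_PiM_unitI borel_measurable_separately_continuous smooth_continuous_on)
    (simp_all add: PiE_def)

lemma one_periodic_dpartial:
  assumes "smooth F" "one_periodic s F" "j < s"
  shows "one_periodic s (dpartial UNIV j F)"
  unfolding one_periodic_def real_space_def
proof (intro ballI allI impI)
  fix y i assume y: "y \<in> dom" and i: "i < s"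
  let ?y' = "y(i := y i + 1)"
  have y': "?y' \<in> dom" using dom_upd[OF y i] by simp
  let ?c = "if i = j then 1 else 0"
  have "F (?y'(j := t + ?c)) = F (y(j := t))" for t
  proof (cases "i = j")
    case True
    then show ?thesis using one_periodicD[OF assms(2) y i] by simp
  next
    case False
    let ?z = "y(j := t)"
    have "?y'(j := t) = ?z(i := ?z i + 1)" using False by auto
    moreover have "F (?z(i := ?z i + 1)) = F ?z"
      using assms(2) dom_upd[OF y assms(3), of t] i
      unfolding one_periodic_def real_space_def by blast
    ultimately show ?thesis using False by simp
  qed
  moreover have "?y'(j := y j + ?c) = ?y'" by auto
  ultimately have "((\<lambda>t. F (y(j := t))) has_real_derivative dpartial UNIV j F ?y') (at (y j))"
    using smooth_has_real_derivative[OF assms(1) y' assms(3), of "y j + ?c"]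
      DERIV_shift[of "\<lambda>t. F (?y'(j := t))" "dpartial UNIV j F ?y'" "y j" ?c] by simp
  moreover have "((\<lambda>t. F (y(j := t))) has_real_derivative dpartial UNIV j F y) (at (y j))"
    using smooth_has_real_derivative[OF assms(1) y assms(3), of "y j"] by simp
  ultimately show "dpartial UNIV j F ?y' = dpartial UNIV j F y" by (rule DERIV_unique)
qed

lemma integrable_mult_character:
  assumes "smooth F" "\<exists>B. \<forall>y\<in>cube s. \<bar>F y\<bar> \<le> B"
  shows "integrable cube_measure (\<lambda>y. complex_of_real (F y) * character s h y)"
proof -
  interpret prob_space cube_measure by (rule prob_space_PiM_unitI)
  obtain B where "\<And>y. y \<in> cube s \<Longrightarrow> \<bar>F y\<bar> \<le> B" using assms(2) by blast
  then show ?thesis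
    using smooth_borel_measurable[OF assms(1)] borel_measurable_character
    by (intro integrable_const_bound[where B = B] AE_I2) (auto simp: norm_mult space_cube_measure)
qed

text \<open>Integration by parts: the boundary terms cancel by periodicity.\<close>

lemma fourier_coeff_dpartial:
  assumes "smooth F" "one_periodic s F" "j < s"
    and "\<exists>B. \<forall>y\<in>cube s. \<bar>F y\<bar> \<le> B" "\<exists>B. \<forall>y\<in>cube s. \<bar>dpartial UNIV j F y\<bar> \<le> B"
  shows "fourier_coeff s (dpartial UNIV j F) h
      = 2 * pi * real_of_int (h j) * \<i> * fourier_coeff s F h"
proof -
  let ?F' = "dpartial UNIV j F" and ?\<chi> = "character s h"
  define k where "k = - 2 * pi * real_of_int (h j)"
  define g where "g y = complex_of_real (F y) * (k *\<^sub>R (\<i> * ?\<chi> y))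
      + complex_of_real (?F' y) * ?\<chi> y" for y
  have g_eq: "g y = k * \<i> * (complex_of_real (F y) * ?\<chi> y) + complex_of_real (?F' y) * ?\<chi> y" for y
    by (simp add: g_def scaleR_conv_of_real)
  have smooth': "smooth ?F'" by (rule smooth_dpartial[OF assms(1,3)])
  note integrable = integrable_mult_character[OF assms(1,4)]
      integrable_mult_character[OF smooth' assms(5)]
  have "(\<integral>t. g (y(j := t)) \<partial>unitI) = 0" if "y \<in> cube s" for y
  proof (rule integral_unitI_deriv_eq_zero)
    let ?H = "\<lambda>t. complex_of_real (F (y(j := t))) * ?\<chi> (y(j := t))"
    have y: "y \<in> dom" using that cube_subset_dom by blast
    show "(?H has_vector_derivative g (y(j := t))) (at t)" for t
      unfolding g_def k_def
      by (intro has_vector_derivative_mult has_vector_derivative_of_real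
          character_has_vector_derivative smooth_has_real_derivative assms(1,3) y)
    have "continuous_on {0..1} (\<lambda>t. ?\<chi> (y(j := t)))"
      using has_vector_derivative_continuous[OF character_has_vector_derivative[OF assms(3)]]
      by (simp add: continuous_at_imp_continuous_on)
    then show "continuous_on {0..1} (\<lambda>t. g (y(j := t)))"
      unfolding g_def by (intro continuous_intros smooth_continuous_on assms(1,3) smooth' y)
    show "?H 1 = ?H 0"
      using one_periodicD[OF assms(2) y assms(3), of 0] character_periodic[OF assms(3), of h y 0]
      by simp
  qed
  then have "(\<integral>y. g y \<partial>cube_measure) = 0"
    using integrable by (intro integral_cube_eq_zero[OF _ assms(3)]) (auto simp: g_eq)
  moreover have "(\<integral>y. g y \<partial>cube_measure) = k * \<i> * fourier_coeff s F h + fourier_coeff s ?F' h"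
    unfolding g_eq fourier_coeff_eq_integral_character using integrable by simp
  ultimately show ?thesis by (simp add: k_def add_eq_0_iff algebra_simps)
qed

lemma cmod_fourier_coeff_partials:
  assumes "smooth F" "one_periodic s F" "set js \<subseteq> {..<s}"
    and "\<And>l. subseq l js \<Longrightarrow> \<exists>B. \<forall>y\<in>cube s. \<bar>partials l F y\<bar> \<le> B"
  shows "cmod (fourier_coeff s (partials js F) h)
    = prod_list (map (\<lambda>j. 2 * pi * \<bar>real_of_int (h j)\<bar>) js) * cmod (fourier_coeff s F h)"
  using assms
proof (induction js arbitrary: F)
  case (Cons j js)
  let ?F' = "dpartial UNIV j F"
  have j: "j < s" using Cons.prems by simp
  have bounds: "\<exists>B. \<forall>y\<in>cube s. \<bar>F y\<bar> \<le> B" "\<exists>B. \<forall>y\<in>cube s. \<bar>?F' y\<bar> \<le> B"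
    using Cons.prems(4)[of "[]"] Cons.prems(4)[of "[j]"] by auto
  have "\<exists>B. \<forall>y\<in>cube s. \<bar>partials l ?F' y\<bar> \<le> B" if "subseq l js" for l
    using Cons.prems(4)[of "j # l"] that by simp
  then have "cmod (fourier_coeff s (partials js ?F') h)
      = prod_list (map (\<lambda>j. 2 * pi * \<bar>real_of_int (h j)\<bar>) js) * cmod (fourier_coeff s ?F' h)"
    using Cons.prems j by (intro Cons.IH smooth_dpartial one_periodic_dpartial) auto
  moreover have "cmod (fourier_coeff s ?F' h)
      = 2 * pi * \<bar>real_of_int (h j)\<bar> * cmod (fourier_coeff s F h)"
    unfolding fourier_coeff_dpartial[OF Cons.prems(1,2) j bounds] by (simp add: norm_mult)
  ultimately show ?case by simp
qed simp

lemma prod_power_mult_cmod_fourier_coeff_le: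
  assumes "smooth F" "one_periodic s F" "majorised UNIV s b w f F" "u \<subseteq> {..<s}"
  shows "(\<Prod>j\<in>u. \<bar>real_of_int (h j)\<bar> ^ \<alpha>) * cmod (fourier_coeff s F h)
    \<le> maj_deriv b w f (\<lambda>_. 0) (directions s (alpha_u \<alpha> u))"
proof -
  interpret prob_space cube_measure by (rule prob_space_PiM_unitI)
  let ?js = "directions s (alpha_u \<alpha> u)"
  have "(\<Prod>j\<in>u. \<bar>real_of_int (h j)\<bar> ^ \<alpha>) \<le> (\<Prod>j\<in>u. (2 * pi * \<bar>real_of_int (h j)\<bar>) ^ \<alpha>)"
  proof (intro prod_mono conjI power_mono)
    show "\<bar>real_of_int (h j)\<bar> \<le> 2 * pi * \<bar>real_of_int (h j)\<bar>" for j
      using mult_right_mono[of 1 "2 * pi" "\<bar>real_of_int (h j)\<bar>"] pi_gt3 by simp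
  qed auto
  also have "\<dots> = prod_list (map (\<lambda>j. 2 * pi * \<bar>real_of_int (h j)\<bar>) ?js)"
    by (simp add: prod_list_directions prod_power_alpha_u[OF assms(4)])
  finally have "(\<Prod>j\<in>u. \<bar>real_of_int (h j)\<bar> ^ \<alpha>) * cmod (fourier_coeff s F h)
      \<le> prod_list (map (\<lambda>j. 2 * pi * \<bar>real_of_int (h j)\<bar>) ?js) * cmod (fourier_coeff s F h)"
    by (intro mult_right_mono) auto
  also have "\<dots> = cmod (fourier_coeff s (partials ?js F) h)"
    using majorised_partials[OF assms(3)]
    by (intro cmod_fourier_coeff_partials[symmetric] assms(1,2) set_directions) blast
  also have "\<dots> \<le> maj_deriv b w f (\<lambda>_. 0) ?js"
    unfolding fourier_coeff_eq_integral_character using assms(3)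
    by (intro norm_integral_le_bound)
      (simp add: norm_mult space_cube_measure majorised_def dmulti_eq_partials)
  finally show ?thesis .
qed

lemma korobov_norm_le_stirling_sum:
  assumes "\<And>u. u \<subseteq> {..<s} \<Longrightarrow> \<gamma> u > 0" "smooth F" "one_periodic s F"
    and "majorised UNIV s (\<lambda>j. c * b j) c (fps_const K * f) F" "K \<ge> 0"
  shows "korobov_norm s \<alpha> \<gamma> F
    \<le> K * Max ((\<lambda>u. c ^ (\<alpha> * card u) / \<gamma> u * stirling_sum b (\<lambda>_. \<alpha>) f u) ` Pow {..<s})"
  unfolding korobov_norm_def
proof (rule cSUP_least)
  show "PiE {..<s} (\<lambda>_. UNIV :: int set) \<noteq> {}" by (simp add: PiE_eq_empty_iff)
  fix h :: "nat \<Rightarrow> int"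
  define u where "u = supp_int s h"
  have u: "u \<subseteq> {..<s}" by (auto simp: u_def supp_int_def)
  have "cmod (fourier_coeff s F h) * r_alpha s \<alpha> \<gamma> h
      = (\<Prod>j\<in>u. \<bar>real_of_int (h j)\<bar> ^ \<alpha>) * cmod (fourier_coeff s F h) / \<gamma> u"
    by (simp add: r_alpha_def u_def)
  also have "\<dots> \<le> maj_deriv (\<lambda>j. c * b j) c (fps_const K * f) (\<lambda>_. 0)
      (directions s (alpha_u \<alpha> u)) / \<gamma> u"
    using assms(1)[OF u]
    by (intro divide_right_mono prod_power_mult_cmod_fourier_coeff_le assms(2-4) u) simp
  also have "\<dots> = K * (c ^ (\<alpha> * card u) / \<gamma> u * stirling_sum b (\<lambda>_. \<alpha>) f u)"
    unfolding maj_deriv_cmult using u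
    by (simp add: maj_deriv_directions mabs_alpha_u stirling_sum_alpha_u)
  also have "\<dots> \<le> K * Max ((\<lambda>u. c ^ (\<alpha> * card u) / \<gamma> u * stirling_sum b (\<lambda>_. \<alpha>) f u) ` Pow {..<s})"
    using u assms(5) by (intro mult_left_mono Max_ge) auto
  finally show "cmod (fourier_coeff s F h) * r_alpha s \<alpha> \<gamma> h \<le> \<dots>" .
qed

end

section \<open>The two architectures\<close>

lemma smooth_fun_ident: "smooth_fun (\<lambda>t. t)"
  and higher_deriv_ident: "(deriv ^^ Suc n) (\<lambda>t :: real. t) = (\<lambda>_. of_bool (n = 0))"
proof -
  define h where "h n t = (if n = 0 then t else of_bool (n = 1))" for n :: nat and t :: real
  have h_deriv: "(h n has_real_derivative h (Suc n) x) (at x)" for n x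
    by (cases "n = 0") (simp_all add: h_def[abs_def])
  have h_zero: "h 0 = (\<lambda>t. t)" by (simp add: h_def fun_eq_iff)
  show "smooth_fun (\<lambda>t. t)"
    using smooth_funI[of h, OF h_deriv] unfolding h_zero .
  show "(deriv ^^ Suc n) (\<lambda>t :: real. t) = (\<lambda>_. of_bool (n = 0))"
    using higher_deriv_eqI[of h "Suc n", OF h_deriv] unfolding h_zero
    by (simp add: h_def fun_eq_iff del: funpow.simps)
qed

lemma smooth_fun_sin: "smooth_fun (\<lambda>t. sin (c * t))"
  and higher_deriv_sin: "(deriv ^^ n) (\<lambda>t. sin (c * t))
      = (\<lambda>t. c ^ n * sin (c * t + real n * (pi / 2)))"
proof -
  define h where "h n t = c ^ n * sin (c * t + real n * (pi / 2))" for n and t :: real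
  have h_deriv: "(h n has_real_derivative h (Suc n) x) (at x)" for n x
  proof -
    have "sin (c * x + real (Suc n) * (pi / 2)) = cos (c * x + real n * (pi / 2))"
      using sin_add[of "c * x + real n * (pi / 2)" "pi / 2"]
      by (simp add: algebra_simps add_divide_distrib)
    then show ?thesis
      unfolding h_def[abs_def] by (auto intro!: derivative_eq_intros)
  qed
  have h_zero: "h 0 = (\<lambda>t. sin (c * t))" by (simp add: h_def fun_eq_iff)
  show "smooth_fun (\<lambda>t. sin (c * t))"
    using smooth_funI[of h, OF h_deriv] unfolding h_zero .
  show "(deriv ^^ n) (\<lambda>t. sin (c * t)) = (\<lambda>t. c ^ n * sin (c * t + real n * (pi / 2)))"
    using higher_deriv_eqI[of h n, OF h_deriv] unfolding h_zero by (simp add: h_def fun_eq_iff)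
qed

lemma stirling_sum_geometric:
  "stirling_sum b (\<lambda>_. \<alpha>) (geometric 1) u = (\<Sum>m\<in>PiE u (\<lambda>_. {0..\<alpha>}). fact (\<Sum>j\<in>u. m j)
    * (\<Prod>j\<in>u. real (Stirling \<alpha> (m j))) * (\<Prod>j\<in>u. b j ^ m j))"
  unfolding stirling_sum_def by (simp add: geometric_nth prod.distrib mult_ac)

lemma stirling_sum_geometric_square:
  "stirling_sum b (\<lambda>_. \<alpha>) (geometric 1 ^ 2) u = (\<Sum>m\<in>PiE u (\<lambda>_. {0..\<alpha>}). fact ((\<Sum>j\<in>u. m j) + 1)
    * (\<Prod>j\<in>u. real (Stirling \<alpha> (m j))) * (\<Prod>j\<in>u. b j ^ m j))"
  unfolding stirling_sum_def by (simp add: geometric_square_nth prod.distrib mult_ac)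

context bounded_network_on
begin

lemma smooth_square_error: "smooth F \<Longrightarrow> smooth (\<lambda>y. (F y - N L p y)^2)"
  unfolding power2_eq_square by (intro smooth_mult smooth_diff smooth_net)

lemma majorised_square_error:
  assumes "C\<^sub>L \<le> C" "p < Nobs"
    and "smooth F" "majorised I s (\<lambda>j. \<omega> * b j) w (fps_const C * geometric 1) F"
  shows "majorised I s (\<lambda>j. \<omega> * b j) w (fps_const (4 * C^2) * geometric 1 ^ 2)
      (\<lambda>y. (F y - N L p y)^2)"
  by (intro majorised_square_diff smooth_net majorised_net assms)

end

sublocale bounded_network \<subseteq> nonperiodic:
  bounded_network_on s L Nobs d W v \<sigma> \<xi> \<tau> R b "{0..1}" "\<lambda>t. t" 1 0
proof (intro bounded_network_on.intro bounded_network_axioms cube_domain_unit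
    bounded_network_on_axioms.intro)
  show "\<bar>(deriv ^^ Suc n) (\<lambda>t :: real. t) x\<bar> \<le> 1 * 0 ^ n" for n x
    unfolding higher_deriv_ident by simp
qed (simp_all add: smooth_fun_ident)

sublocale bounded_network \<subseteq> periodic:
  bounded_network_on s L Nobs d W v \<sigma> \<xi> \<tau> R b UNIV "\<lambda>t. sin (2 * pi * t)" "2 * pi" "2 * pi"
proof (intro bounded_network_on.intro bounded_network_axioms cube_domain_UNIV
    bounded_network_on_axioms.intro)
  show "\<bar>(deriv ^^ Suc n) (\<lambda>t. sin (2 * pi * t)) x\<bar> \<le> 2 * pi * (2 * pi) ^ n" for n x
    unfolding higher_deriv_sin abs_mult
    using mult_left_mono[OF abs_sin_le_one, of "(2 * pi) ^ Suc n"] by (simp add: power_abs)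
qed (simp_all add: smooth_fun_sin)

context bounded_network
begin

lemma nonperiodic_sobolev_bounds:
  assumes \<gamma>_pos: "\<And>u. u \<subseteq> {..<s} \<Longrightarrow> \<gamma> u > 0"
    and C_bound: "nonperiodic.C\<^sub>L \<le> C" "p < Nobs"
    and F: "smooth_on {0..1} s F" "majorised {0..1} s b 0 (fps_const C * geometric 1) F"
  shows "max (sob_sq s 1 \<gamma> F) (sob_sq s 1 \<gamma> (nonperiodic.N L p))
      \<le> C^2 * (\<Sum>u\<in>Pow {..<s}. (1 / \<gamma> u) * (fact (card u) * (\<Prod>j\<in>u. b j))^2)" (is ?norms)
    and "sob_sq s 1 \<gamma> (\<lambda>y. (F y - nonperiodic.N L p y)^2)
      \<le> 16 * C^4 * (\<Sum>u\<in>Pow {..<s}. (1 / \<gamma> u) * (fact (card u + 1) * (\<Prod>j\<in>u. b j))^2)" (is ?error)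
proof -
  note bound = sob_sq_le_zero_frequency[OF \<gamma>_pos]
  show ?norms
    using bound[OF _ F(2)] bound[OF _ nonperiodic.majorised_net[OF C_bound, unfolded mult_1]]
    by (simp add: geometric_nth)
  have "majorised {0..1} s b 0 (fps_const (4 * C^2) * geometric 1 ^ 2)
      (\<lambda>y. (F y - nonperiodic.N L p y)^2)"
    using nonperiodic.majorised_square_error[OF C_bound F(1)] F(2) by simp
  from bound[OF _ this] show ?error
    by (simp add: geometric_square_nth power_mult_distrib power_mult[symmetric]
        mult.commute[of "fact _"])
qed

lemma periodic_sobolev_bounds:
  assumes \<gamma>_pos: "\<And>u. u \<subseteq> {..<s} \<Longrightarrow> \<gamma> u > 0"
    and C_bound: "periodic.C\<^sub>L \<le> C" "p < Nobs"
    and F: "smooth_on UNIV s F"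
      "majorised UNIV s (\<lambda>j. 2 * pi * b j) (2 * pi) (fps_const C * geometric 1) F"
  shows "max (sob_sq s \<alpha> \<gamma> F) (sob_sq s \<alpha> \<gamma> (periodic.N L p))
      \<le> C^2 * (\<Sum>u\<in>Pow {..<s}. (2 * pi) ^ (2 * \<alpha> * card u) / \<gamma> u
          * (stirling_sum b (\<lambda>_. \<alpha>) (geometric 1) u)^2)" (is ?norms)
    and "sob_sq s \<alpha> \<gamma> (\<lambda>y. (F y - periodic.N L p y)^2)
      \<le> 16 * C^4 * (\<Sum>u\<in>Pow {..<s}. (2 * pi) ^ (2 * \<alpha> * card u) / \<gamma> u
          * (stirling_sum b (\<lambda>_. \<alpha>) (geometric 1 ^ 2) u)^2)" (is ?error)
proof -
  note bound = sob_sq_le_stirling_sum[OF \<gamma>_pos]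
  show ?norms
    by (intro max.boundedI bound F periodic.smooth_net periodic.majorised_net C_bound)
  have "16 * C^4 = (4 * C^2)^2" by (simp add: power_mult_distrib flip: power_mult)
  then show ?error
    using bound[OF _ periodic.smooth_square_error[OF F(1)]
        periodic.majorised_square_error[OF C_bound F]] by simp
qed

lemma periodic_korobov_bounds:
  assumes \<gamma>_pos: "\<And>u. u \<subseteq> {..<s} \<Longrightarrow> \<gamma> u > 0" and C_pos: "C > 0"
    and C_bound: "periodic.C\<^sub>L \<le> C" "p < Nobs"
    and F: "smooth_on UNIV s F" "one_periodic s F"
      "majorised UNIV s (\<lambda>j. 2 * pi * b j) (2 * pi) (fps_const C * geometric 1) F"
  shows "max (korobov_norm s \<alpha> \<gamma> F) (korobov_norm s \<alpha> \<gamma> (periodic.N L p))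
      \<le> C * Max ((\<lambda>u. (2 * pi) ^ (\<alpha> * card u) / \<gamma> u
          * stirling_sum b (\<lambda>_. \<alpha>) (geometric 1) u) ` Pow {..<s})" (is ?norms)
    and "korobov_norm s \<alpha> \<gamma> (\<lambda>y. (F y - periodic.N L p y)^2)
      \<le> 4 * C^2 * Max ((\<lambda>u. (2 * pi) ^ (\<alpha> * card u) / \<gamma> u
          * stirling_sum b (\<lambda>_. \<alpha>) (geometric 1 ^ 2) u) ` Pow {..<s})" (is ?error)
proof -
  interpret real_domain s by (rule real_domain.intro[OF cube_domain_UNIV])
  have "sin (2 * pi * (t + 1)) = sin (2 * pi * t)" for t :: real
    using sin_periodic[of "2 * pi * t"] by (simp add: algebra_simps)
  note net_periodic = net_periodic[of "\<lambda>t. sin (2 * pi * t)", OF this]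
  have one_periodic_net: "one_periodic s (periodic.N L p)"
    "one_periodic s (\<lambda>y. (F y - periodic.N L p y)^2)"
    using F(2) unfolding one_periodic_def net_periodic by simp_all
  note bound = korobov_norm_le_stirling_sum[OF \<gamma>_pos]
  show ?norms
    using C_pos
    by (intro max.boundedI bound F periodic.smooth_net one_periodic_net
        periodic.majorised_net C_bound) simp_all
  show ?error
    by (intro bound periodic.smooth_square_error one_periodic_net periodic.majorised_square_error
        C_bound F) simp_all
qed

end

theorem theorem3p2:
  fixes s L Nobs :: nat and d :: "nat \<Rightarrow> nat"
    and W :: "nat \<Rightarrow> nat \<Rightarrow> nat \<Rightarrow> real" and v :: "nat \<Rightarrow> nat \<Rightarrow> real"
    and \<sigma> :: "real \<Rightarrow> real" and \<xi> \<tau> \<rho> C :: real and R b :: "nat \<Rightarrow> real"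
    and \<gamma> :: "nat set \<Rightarrow> real"
  assumes s_pos: "s \<ge> 1" and L_pos: "L \<ge> 1"
    and d0: "d 0 = s" and dL: "d (Suc L) = Nobs" and d_pos: "\<forall>l\<le>Suc L. d l \<ge> 1"
    and \<sigma>_smooth: "\<forall>n x. ((deriv ^^ n) \<sigma> has_real_derivative (deriv ^^ Suc n) \<sigma> x) (at x)"
    and \<sigma>_bound: "\<forall>n\<ge>1. \<forall>x. \<bar>(deriv ^^ n) \<sigma> x\<bar> \<le> \<xi> * \<tau> ^ n * fact n"
    and \<xi>_pos: "\<xi> > 0" and \<tau>_pos: "\<tau> > 0"
    and R_pos: "\<forall>l\<in>{1..L}. R l > 0"
    and W_norm: "\<forall>l\<in>{1..L}. mat_inf_norm W d l \<le> R l"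
    and \<rho>_pos: "\<rho> > 0" and R_\<rho>: "\<forall>l\<in>{1..L-1}. R l \<le> \<rho>"
    and b_pos: "\<forall>j. b j > 0" and C_pos: "C > 0"
    and \<beta>_bound: "\<forall>j<s. beta W d j \<le> b j / SL \<xi> \<tau> R L"
    and \<gamma>_pos: "\<forall>u\<subseteq>{..<s}. \<gamma> u > 0" and \<gamma>_empty: "\<gamma> {} = 1"
  shows
   "(if \<xi> * \<tau> * \<rho> = 1 then SL \<xi> \<tau> R L \<le> \<tau> * real L
     else SL \<xi> \<tau> R L \<le> \<tau> * (((\<xi> * \<tau> * \<rho>) ^ L - 1) / (\<xi> * \<tau> * \<rho> - 1)))
    \<and>
    (\<forall>G :: (nat \<Rightarrow> real) \<Rightarrow> nat \<Rightarrow> real.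
       max (net_sup s Nobs (net \<sigma> W v d (\<lambda>t. t) L)) (Pk \<xi> \<tau> R L / SL \<xi> \<tau> R L) \<le> C \<longrightarrow>
       (\<forall>p<Nobs. smooth_on {0..1} s (\<lambda>y. G y p)) \<longrightarrow>
       (\<forall>\<nu> :: nat \<Rightarrow> nat. \<forall>y\<in>cube s. \<forall>p<Nobs.
          \<bar>dmulti {0..1} s \<nu> (\<lambda>y. G y p) y\<bar> \<le> C * fact (mabs s \<nu>) * bpow s b \<nu>) \<longrightarrow>
       (\<forall>\<nu> :: nat \<Rightarrow> nat. \<forall>y\<in>cube s. \<forall>p<Nobs.
          \<bar>dmulti {0..1} s \<nu> (\<lambda>y. net \<sigma> W v d (\<lambda>t. t) L y p) y\<bar>
            \<le> C * fact (mabs s \<nu>) * bpow s b \<nu>)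
       \<and> (\<forall>p<Nobs.
          max (sob_sq s 1 \<gamma> (\<lambda>y. G y p)) (sob_sq s 1 \<gamma> (\<lambda>y. net \<sigma> W v d (\<lambda>t. t) L y p))
            \<le> C^2 * (\<Sum>u\<in>Pow {..<s}. (1 / \<gamma> u) * (fact (card u) * (\<Prod>j\<in>u. b j))^2)
          \<and> sob_sq s 1 \<gamma> (\<lambda>y. (G y p - net \<sigma> W v d (\<lambda>t. t) L y p)^2)
            \<le> 16 * C^4 * (\<Sum>u\<in>Pow {..<s}. (1 / \<gamma> u) * (fact (card u + 1) * (\<Prod>j\<in>u. b j))^2)))
    \<and>
    (\<forall>G :: (nat \<Rightarrow> real) \<Rightarrow> nat \<Rightarrow> real.
       max (net_sup s Nobs (net \<sigma> W v d (\<lambda>t. sin (2 * pi * t)) L)) (Pk \<xi> \<tau> R L / SL \<xi> \<tau> R L) \<le> C \<longrightarrow>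
       (\<forall>p<Nobs. smooth_on UNIV s (\<lambda>y. G y p)) \<longrightarrow>
       (\<forall>y\<in>real_space s. \<forall>j<s. \<forall>p<Nobs. G (y(j := y j + 1)) p = G y p) \<longrightarrow>
       (\<forall>\<nu> :: nat \<Rightarrow> nat. \<forall>y\<in>cube s. \<forall>p<Nobs.
          \<bar>dmulti UNIV s \<nu> (\<lambda>y. G y p) y\<bar> \<le> C * (2 * pi) ^ mabs s \<nu> * per_bound s b \<nu>) \<longrightarrow>
       (\<forall>\<nu> :: nat \<Rightarrow> nat. \<forall>y\<in>cube s. \<forall>p<Nobs.
          \<bar>dmulti UNIV s \<nu> (\<lambda>y. net \<sigma> W v d (\<lambda>t. sin (2 * pi * t)) L y p) y\<bar>
            \<le> C * (2 * pi) ^ mabs s \<nu> * per_bound s b \<nu>)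
       \<and> (\<forall>\<alpha>::nat. \<alpha> \<ge> 1 \<longrightarrow> (\<forall>p<Nobs.
          max (sob_sq s \<alpha> \<gamma> (\<lambda>y. G y p))
              (sob_sq s \<alpha> \<gamma> (\<lambda>y. net \<sigma> W v d (\<lambda>t. sin (2 * pi * t)) L y p))
            \<le> C^2 * (\<Sum>u\<in>Pow {..<s}. (2 * pi) ^ (2 * \<alpha> * card u) / \<gamma> u *
                 (\<Sum>m\<in>PiE u (\<lambda>_. {0..\<alpha>}). fact (\<Sum>j\<in>u. m j)
                    * (\<Prod>j\<in>u. real (Stirling \<alpha> (m j))) * (\<Prod>j\<in>u. b j ^ m j))^2)
          \<and> sob_sq s \<alpha> \<gamma> (\<lambda>y. (G y p - net \<sigma> W v d (\<lambda>t. sin (2 * pi * t)) L y p)^2)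
            \<le> 16 * C^4 * (\<Sum>u\<in>Pow {..<s}. (2 * pi) ^ (2 * \<alpha> * card u) / \<gamma> u *
                 (\<Sum>m\<in>PiE u (\<lambda>_. {0..\<alpha>}). fact ((\<Sum>j\<in>u. m j) + 1)
                    * (\<Prod>j\<in>u. real (Stirling \<alpha> (m j))) * (\<Prod>j\<in>u. b j ^ m j))^2)))
       \<and> (\<forall>\<alpha>::nat. \<alpha> \<ge> 2 \<longrightarrow> (\<forall>p<Nobs.
          max (korobov_norm s \<alpha> \<gamma> (\<lambda>y. G y p))
              (korobov_norm s \<alpha> \<gamma> (\<lambda>y. net \<sigma> W v d (\<lambda>t. sin (2 * pi * t)) L y p))
            \<le> C * Max ((\<lambda>u. (2 * pi) ^ (\<alpha> * card u) / \<gamma> u *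
                 (\<Sum>m\<in>PiE u (\<lambda>_. {0..\<alpha>}). fact (\<Sum>j\<in>u. m j)
                    * (\<Prod>j\<in>u. real (Stirling \<alpha> (m j))) * (\<Prod>j\<in>u. b j ^ m j))) ` Pow {..<s})
          \<and> korobov_norm s \<alpha> \<gamma> (\<lambda>y. (G y p - net \<sigma> W v d (\<lambda>t. sin (2 * pi * t)) L y p)^2)
            \<le> 4 * C^2 * Max ((\<lambda>u. (2 * pi) ^ (\<alpha> * card u) / \<gamma> u *
                 (\<Sum>m\<in>PiE u (\<lambda>_. {0..\<alpha>}). fact ((\<Sum>j\<in>u. m j) + 1)
                    * (\<Prod>j\<in>u. real (Stirling \<alpha> (m j))) * (\<Prod>j\<in>u. b j ^ m j))) ` Pow {..<s}))))"
proof -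
  interpret bounded_network s L Nobs d W v \<sigma> \<xi> \<tau> R b
    using assms by unfold_locales (auto simp: smooth_fun_def)
  have \<gamma>: "\<gamma> u > 0" if "u \<subseteq> {..<s}" for u
    using \<gamma>_pos that by blast
  show ?thesis
    unfolding stirling_sum_geometric[symmetric] stirling_sum_geometric_square[symmetric]
  proof ((intro conjI; (rule allI, intro impI)?), goal_cases)
    case 1
    show ?case by (rule S_le[OF \<rho>_pos R_\<rho>])
  next
    case (2 G)
    then have G: "smooth_on {0..1} s (\<lambda>y. G y p)"
      "majorised {0..1} s b 0 (fps_const C * geometric 1) (\<lambda>y. G y p)" if "p < Nobs" for p
      using that by (simp_all add: majorised_zero_iff)
    show ?case
      using nonperiodic.majorised_net[OF 2(1), unfolded mult_1 majorised_zero_iff]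
        nonperiodic_sobolev_bounds[OF \<gamma> 2(1) _ G] by simp
  next
    case (3 G)
    then have G: "smooth_on UNIV s (\<lambda>y. G y p)" "one_periodic s (\<lambda>y. G y p)"
      "majorised UNIV s (\<lambda>j. 2 * pi * b j) (2 * pi) (fps_const C * geometric 1) (\<lambda>y. G y p)"
      if "p < Nobs" for p
      using that by (simp_all add: majorised_per_bound_iff one_periodic_def)
    show ?case
      using periodic.majorised_net[OF 3(1), unfolded majorised_per_bound_iff]
        periodic_sobolev_bounds[OF \<gamma> 3(1) _ G(1,3)] periodic_korobov_bounds[OF \<gamma> C_pos 3(1) _ G] by simp
  qed
qed

end
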